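(* Let $d\in\{1,2\}$. Suppose that $\Omega$ is a union of three disjoint unit intervals in $\mathbb{R}^1$ (if $d=1$), or a union of three disjoint axis-parallel unit squares in $\mathbb{R}^2$ (if $d=2$). If $\Omega$ is a weak tile in $\mathbb{R}^d$, then $\Omega$ is both a tile and a spectral set in $\mathbb{R}^d$.
   Context: Unit intervals and axis-parallel unit squares are translates of $(0,1)$ and $(0,1)^2$ respectively. Let $\Omega\subset\mathbb{R}^d$ be bounded and measurable with finite positive Lebesgue measure. $\Omega$ is a (translational) tile of $\mathbb{R}^d$ if there is a countable set $T\subset\mathbb{R}^d$ with $\sum_{t\in T}\mathbf{1}_\Omega(x-t)=1$ for a.e. $x\in\mathbb{R}^d$. $\Omega$ is a spectral set if there is a countable $\Lambda\subset\mathbb{R}^d$ such that $\{e^{2\pi i\langle\lambda,x\rangle}\}_{\lambda\in\Lambda}$ is an orthogonal basis of $L^2(\Omega)$. $\Omega$ is a weak tile of $\mathbb{R}^d$ if there is a positive (i.e. non-negative), locally finite Borel measure $\mu$ on $\mathbb{R}^d$ with $\mathbf{1}_\Omega*\mu=\mathbf{1}_{\Omega^c}$ a.e.; equivalently, there is a non-negative locally finite measure $\nu$ with $\mathbf{1}_\Omega*\nu=1$ a.e. and $\nu(\{0\})=1$. *)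

theory Defs
  imports "HOL-Analysis.Analysis"
begin

text \<open>The ambient space $\mathbb{R}^d$ is an arbitrary type of class
  \<^class>\<open>euclidean_space\<close> with \<open>DIM('a) = d\<close>; its coordinate axes are those given by \<open>Basis\<close>, and
  \<open>One\<close> is the all-ones vector. Taking \<open>'a = real\<close> or \<open>'a = real^2\<close> gives the usual line and plane.\<close>

definition unit_cube :: "'a::euclidean_space \<Rightarrow> 'a set" where
  "unit_cube a = (\<lambda>x. a + x) ` box 0 One"

definition admissible_domain :: "'a::euclidean_space set \<Rightarrow> bool" where
  "admissible_domain \<Omega> \<longleftrightarrow>
     bounded \<Omega> \<and> \<Omega> \<in> sets lebesgue \<and> 0 < emeasure lebesgue \<Omega> \<and> emeasure lebesgue \<Omega> < \<infinity>"

definition is_tile :: "'a::euclidean_space set \<Rightarrow> bool" where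
  "is_tile \<Omega> \<longleftrightarrow> admissible_domain \<Omega> \<and>
     (\<exists>T. countable T \<and>
       (AE x in lebesgue. ((\<lambda>t. indicator \<Omega> (x - t) :: real) has_sum 1) T))"

definition locally_finite_borel_measure :: "'a::euclidean_space measure \<Rightarrow> bool" where
  "locally_finite_borel_measure \<mu> \<longleftrightarrow> sets \<mu> = sets borel \<and>
     (\<forall>x. \<exists>U. open U \<and> x \<in> U \<and> emeasure \<mu> U < \<infinity>)"

text \<open>The convolution $(\mathbf{1}_\Omega * \mu)(x) = \int \mathbf{1}_\Omega(x - y)\,d\mu(y)$, with values
  in $[0,\infty]$.\<close>

definition indicator_conv :: "'a::euclidean_space set \<Rightarrow> 'a measure \<Rightarrow> 'a \<Rightarrow> ennreal" where
  "indicator_conv \<Omega> \<mu> x = (\<integral>\<^sup>+ y. indicator \<Omega> (x - y) \<partial>\<mu>)"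

definition is_weak_tile :: "'a::euclidean_space set \<Rightarrow> bool" where
  "is_weak_tile \<Omega> \<longleftrightarrow> admissible_domain \<Omega> \<and>
     (\<exists>\<mu>. locally_finite_borel_measure \<mu> \<and>
       (AE x in lebesgue. indicator_conv \<Omega> \<mu> x = indicator (- \<Omega>) x))"

text \<open>Elements of $L^2(M)$ are represented by functions, not by almost-everywhere classes.\<close>

definition L2_fun :: "'b measure \<Rightarrow> ('b \<Rightarrow> complex) set" where
  "L2_fun M = {f \<in> borel_measurable M. integrable M (\<lambda>x. (norm (f x))\<^sup>2)}"

definition L2_inner :: "'b measure \<Rightarrow> ('b \<Rightarrow> complex) \<Rightarrow> ('b \<Rightarrow> complex) \<Rightarrow> complex" where
  "L2_inner M f g = (\<integral>x. f x * cnj (g x) \<partial>M)"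

definition L2_norm :: "'b measure \<Rightarrow> ('b \<Rightarrow> complex) \<Rightarrow> real" where
  "L2_norm M f = sqrt (\<integral>x. (norm (f x))\<^sup>2 \<partial>M)"

text \<open>An orthogonal basis in the Hilbert space sense: nonzero, pairwise orthogonal elements whose
  finite linear combinations are dense.\<close>

definition orthogonal_basis_L2 ::
    "'b measure \<Rightarrow> ('i \<Rightarrow> 'b \<Rightarrow> complex) \<Rightarrow> 'i set \<Rightarrow> bool" where
  "orthogonal_basis_L2 M e I \<longleftrightarrow>
     (\<forall>i\<in>I. e i \<in> L2_fun M \<and> L2_norm M (e i) \<noteq> 0) \<and>
     (\<forall>i\<in>I. \<forall>j\<in>I. i \<noteq> j \<longrightarrow> L2_inner M (e i) (e j) = 0) \<and>
     (\<forall>f\<in>L2_fun M. \<forall>\<epsilon>>0. \<exists>F c. finite F \<and> F \<subseteq> I \<and>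
        L2_norm M (\<lambda>x. f x - (\<Sum>i\<in>F. c i * e i x)) < \<epsilon>)"

definition expo :: "'a::euclidean_space \<Rightarrow> 'a \<Rightarrow> complex" where
  "expo l x = exp (2 * of_real pi * \<i> * of_real (l \<bullet> x))"

definition is_spectral :: "'a::euclidean_space set \<Rightarrow> bool" where
  "is_spectral \<Omega> \<longleftrightarrow> admissible_domain \<Omega> \<and>
     (\<exists>\<Lambda>. countable \<Lambda> \<and> orthogonal_basis_L2 (lebesgue_on \<Omega>) expo \<Lambda>)"

end

theory Submission imports Defs begin

text \<open>Write \<open>\<nu> = \<mu> + \<delta>\<^sub>0\<close> and \<open>F = 1\<^bsub>Q\<^esub> * \<nu>\<close> for the open unit cube \<open>Q\<close>. With \<open>u = b - a\<close>, \<open>v = c - a\<close>, the weak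
  tiling equation becomes \<open>F(x) + F(x - u) + F(x - v) = 1\<close> almost everywhere, with \<open>F\<close> bounded. On each orbit of
  the group generated by \<open>u\<close> and \<open>v\<close>, the function \<open>F - 1/3\<close> is harmonic for a random walk, hence periodic by the
  Choquet--Deny argument, and therefore \<open>F(x) + F(x - m) + F(x + m) = 1\<close> for every \<open>m = i u + j v\<close> with
  \<open>i \<noteq> j\<close> modulo 3. So the cube weakly tiles with the sum of \<open>\<nu>\<close> and its translates by \<open>m\<close> and \<open>- m\<close>, which has
  atoms of mass at least 1 at \<open>0\<close> and \<open>m\<close>; as in Keller's theorem, some coordinate of \<open>m\<close> is a nonzero integer.

  This arithmetic condition on all such \<open>m\<close> is also sufficient. It forces one coordinate of \<open>u\<close> and \<open>v\<close> to be
  integral, and after a shear in the other coordinate (or none) the \<open>e\<close>-coordinates of \<open>0, u, v\<close>, for a suitable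
  axis \<open>e\<close>, are a positive integer \<open>N\<close> times a complete residue system modulo 3. A tiling set is then given by
  the integer points whose \<open>e\<close>-coordinate lies in \<open>{0..<N} + 3N\<int>\<close>, and a spectrum by the integer points
  translated by \<open>0, 1/(3N), 2/(3N)\<close> times \<open>e\<close>, up to the shear and its transpose.\<close>

section \<open>Bounded solutions of a three-term relation\<close>

text \<open>The hypothesis holds only almost everywhere, while the conclusion drawn from it concerns
  atoms. Two devices bridge this. Orbits under \<open>u\<close> and \<open>v\<close> are countable,
  so almost every orbit satisfies the relation at all of its points, and harmonicity can be used
  pointwise there. Mass one of generic open boxes passes in the limit to half-open boxes at every
  position and with every choice of closed faces; comparing two choices isolates facets, and in the
  plane the endpoints of facets, hence atoms. The number 3 enters because F - 1/3 is invariant under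
  u + v and 3u: on an orbit it depends only on i - j modulo 3, and the relation says that its three
  values have sum 0. Any m in a nonzero class runs through the same three values. For the converse,
  the sheared cubes are fundamental domains of the integer lattice, so almost every point of the
  torus has one preimage in each cube. The sheared e-coordinates of these three preimages differ by
  N times differences of distinct residues modulo 3, and both the tiling set and the spectrum are
  built to separate them.\<close>

text \<open>The increment \<open>D\<close> of \<open>h\<close> along \<open>s1\<close> is itself
  bounded and harmonic. Where \<open>D\<close> is close to a positive supremum, it must remain close
  at the next point along \<open>s1\<close>, since the other two terms of the average cannot exceed
  the supremum. Then \<open>h\<close> grows linearly for as long as desired, against
  boundedness.\<close>

lemma bounded_harmonic_increment_nonpos:
  fixes h :: "'a::real_vector \<Rightarrow> real" and s1 s2 s3 :: 'a
  assumes cl: "\<And>x. x \<in> X \<Longrightarrow> x + s1 \<in> X" "\<And>x. x \<in> X \<Longrightarrow> x + s2 \<in> X" "\<And>x. x \<in> X \<Longrightarrow> x + s3 \<in> X"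
    and bd: "\<And>x. x \<in> X \<Longrightarrow> \<bar>h x\<bar> \<le> C"
    and harm: "\<And>x. x \<in> X \<Longrightarrow> 3 * h x = h (x + s1) + h (x + s2) + h (x + s3)"
    and x: "x \<in> X"
  shows "h (x + s1) \<le> h x"
proof (rule ccontr)
  assume neg: "\<not> h (x + s1) \<le> h x"
  define D where "D y = h (y + s1) - h y" for y
  define M where "M = Sup (D ` X)"
  have Dle: "D y \<le> 2 * C" if "y \<in> X" for y
    using bd[OF that] bd[OF cl(1)[OF that]] by (simp add: D_def)
  have bdd: "bdd_above (D ` X)"
    using Dle by (auto simp: bdd_above_def)
  have DM: "D y \<le> M" if "y \<in> X" for y
    unfolding M_def using bdd that by (simp add: cSUP_upper)
  have "0 < D x" using neg by (simp add: D_def)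
  then have M: "0 < M" using DM[OF x] by simp
  have Dharm: "3 * D y = D (y + s1) + D (y + s2) + D (y + s3)" if "y \<in> X" for y
    using harm[OF that] harm[OF cl(1)[OF that]] by (simp add: D_def add_ac)
  \<comment> \<open>A gain of M/2 in each of \<open>n\<close> steps exceeds 2C, the largest possible
    variation of \<open>h\<close>.\<close>
  obtain n :: nat where n: "2 * C < real n * (M / 2)"
    using reals_Archimedean3[of "M / 2"] M by (metis half_gt_zero)
  \<comment> \<open>The gap between \<open>D\<close> and \<open>M\<close> at most triples at each
    step, so this initial gap stays below M/2 for \<open>n\<close> steps.\<close>
  define eps where "eps = M / (2 * 3 ^ n)"
  have "eps > 0" using M by (simp add: eps_def)
  then have "M - eps < Sup (D ` X)" by (simp add: M_def)
  then obtain y where y: "y \<in> X" "M - eps < D y"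
    using less_cSup_iff[OF _ bdd] x by blast
  have iter: "y + real k *\<^sub>R s1 \<in> X \<and> M - 3 ^ k * eps < D (y + real k *\<^sub>R s1)" for k
  proof (induction k)
    case 0 then show ?case using y by simp
  next
    case (Suc k)
    let ?z = "y + real k *\<^sub>R s1"
    have z: "?z \<in> X" "M - 3 ^ k * eps < D ?z" using Suc by auto
    have eq: "y + real (Suc k) *\<^sub>R s1 = ?z + s1" by (simp add: algebra_simps)
    have "D (?z + s1) > M - 3 * (3 ^ k * eps)"
      using Dharm[OF z(1)] z(2) DM[OF cl(2)[OF z(1)]] DM[OF cl(3)[OF z(1)]] by linarith
    then show ?case unfolding eq using cl(1)[OF z(1)] by (simp add: mult_ac)
  qed
  have half: "M / 2 \<le> D (y + real k *\<^sub>R s1)" if "k \<le> n" for k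
  proof -
    have "3 ^ k * eps \<le> 3 ^ n * eps"
      using that \<open>eps > 0\<close> by (simp add: power_increasing)
    also have "\<dots> = M / 2" by (simp add: eps_def)
    finally show ?thesis using iter[of k] by linarith
  qed
  have "real k * (M / 2) \<le> h (y + real k *\<^sub>R s1) - h y" if "k \<le> n" for k
    using that
  proof (induction k)
    case 0 then show ?case by simp
  next
    case (Suc k)
    have "y + real (Suc k) *\<^sub>R s1 = y + real k *\<^sub>R s1 + s1" by (simp add: algebra_simps)
    then show ?case using Suc half[of k] by (simp add: D_def algebra_simps add_divide_distrib)
  qed
  from this[of n] have "real n * (M / 2) \<le> 2 * C"
    using bd[OF y(1)] bd[of "y + real n *\<^sub>R s1"] iter[of n] by force
  with n show False by simp
qed

lemma bounded_harmonic_invariant: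
  fixes h :: "'a::real_vector \<Rightarrow> real" and s1 s2 s3 :: 'a
  assumes cl: "\<And>x. x \<in> X \<Longrightarrow> x + s1 \<in> X" "\<And>x. x \<in> X \<Longrightarrow> x + s2 \<in> X" "\<And>x. x \<in> X \<Longrightarrow> x + s3 \<in> X"
    and bd: "\<And>x. x \<in> X \<Longrightarrow> \<bar>h x\<bar> \<le> C"
    and harm: "\<And>x. x \<in> X \<Longrightarrow> 3 * h x = h (x + s1) + h (x + s2) + h (x + s3)"
    and x: "x \<in> X"
  shows "h (x + s1) = h x"
proof (rule antisym)
  show "h (x + s1) \<le> h x"
    by (rule bounded_harmonic_increment_nonpos[OF cl bd harm x])
  have "- h (x + s1) \<le> - h x"
    by (rule bounded_harmonic_increment_nonpos[where h = "\<lambda>x. - h x", OF cl _ _ x, where C = C])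
       (use bd harm in auto)
  then show "h x \<le> h (x + s1)" by simp
qed

lemma int_periodic:
  fixes h :: "'a::real_vector \<Rightarrow> real"
  assumes cl: "\<And>x i. x \<in> X \<Longrightarrow> x + of_int i *\<^sub>R s \<in> X"
    and per: "\<And>x. x \<in> X \<Longrightarrow> h (x + s) = h x" and x: "x \<in> X"
  shows "h (x + of_int n *\<^sub>R s) = h x"
proof -
  have nat: "h (x + real k *\<^sub>R s) = h x" if "x \<in> X" for k x
    using that
  proof (induction k)
    case (Suc k)
    have "x + real k *\<^sub>R s \<in> X" using cl[OF Suc.prems, of "int k"] by simp
    from per[OF this] Suc show ?case by (simp add: algebra_simps)
  qed simp
  show ?thesis
  proof (cases n rule: int_cases2)
    case (nonneg k) then show ?thesis using nat[OF x] by simp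
  next
    case (nonpos k)
    have "x + of_int n *\<^sub>R s \<in> X" using cl[OF x] .
    from nat[OF this, of k] show ?thesis using nonpos by simp
  qed
qed

text \<open>As operators, \<open>1\<close>, the shift by \<open>u\<close> and the shift by \<open>v\<close> have sum \<open>0\<close> on \<open>h\<close>; the identity
  \<open>x\<^sup>3 + y\<^sup>3 + z\<^sup>3 = 3xyz\<close> for \<open>x + y + z = 0\<close>, divided by \<open>xyz\<close>, exhibits \<open>h\<close> as harmonic for a
  random walk with three steps.\<close>

lemma three_term_relation_spread:
  fixes h :: "'a::real_vector \<Rightarrow> real" and u v :: 'a
  assumes cl: "\<And>x i j. x \<in> X \<Longrightarrow> x + of_int i *\<^sub>R u + of_int j *\<^sub>R v \<in> X"
    and bd: "\<And>x. x \<in> X \<Longrightarrow> \<bar>h x\<bar> \<le> C"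
    and rel: "\<And>x. x \<in> X \<Longrightarrow> h x + h (x - u) + h (x - v) = 0"
    and ij: "(i - j) mod 3 \<noteq> (0::int)" and x: "x \<in> X"
  defines "m \<equiv> of_int i *\<^sub>R u + of_int j *\<^sub>R v"
  shows "h x + h (x - m) + h (x + m) = 0"
proof -
  have cl': "x + (of_int i *\<^sub>R u + of_int j *\<^sub>R v) \<in> X" if "x \<in> X" for x i j
    using cl[OF that, of i j] by (simp add: add.assoc)
  \<comment> \<open>With x = 1 and y, z the operators taking h to h(. - u) and h(. - v), these are
    the displacements of x^2/(yz), y^2/(xz) and z^2/(xy).\<close>
  define s1 s2 s3 where "s1 = u + v" and "s2 = v - 2 *\<^sub>R u" and "s3 = u - 2 *\<^sub>R v"
  note s_defs = s1_def s2_def s3_def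
  have c: "x + s1 \<in> X" "x + s2 \<in> X" "x + s3 \<in> X" if "x \<in> X" for x
    using cl[OF that, of 1 1] cl[OF that, of "-2" 1] cl[OF that, of 1 "-2"]
    by (simp_all add: s_defs algebra_simps)
  \<comment> \<open>The six instances of \<open>rel\<close> are the terms of the cofactor x^2 + y^2
    + z^2 - xy - yz - zx of x + y + z in x^3 + y^3 + z^3 - 3xyz, divided by xyz: three enter with
    sign plus, three with sign minus.\<close>
  have harm: "3 * h x = h (x + s1) + h (x + s2) + h (x + s3)" if "x \<in> X" for x
  proof -
    have "h (x + u + v) + h (x + v) + h (x + u) = 0"
      using rel[of "x + u + v"] cl[OF that, of 1 1] by simp
    moreover have "h (x - u + v) + h (x + v - 2 *\<^sub>R u) + h (x - u) = 0"
      using rel[of "x - u + v"] cl[OF that, of "-1" 1] by (simp add: algebra_simps scaleR_2)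
    moreover have "h (x + u - v) + h (x - v) + h (x + u - 2 *\<^sub>R v) = 0"
      using rel[of "x + u - v"] cl[OF that, of 1 "-1"] by (simp add: algebra_simps scaleR_2)
    moreover have "h (x + v) + h (x - u + v) + h x = 0"
      using rel[of "x + v"] cl[OF that, of 0 1] by (simp add: algebra_simps)
    moreover have "h (x + u) + h x + h (x + u - v) = 0"
      using rel[of "x + u"] cl[OF that, of 1 0] by (simp add: algebra_simps)
    ultimately show ?thesis using rel[OF that]
      by (simp add: s_defs algebra_simps)
  qed
  have p1: "h (x + s1) = h x" if "x \<in> X" for x
    by (rule bounded_harmonic_invariant[OF c bd harm that])
  have p2: "h (x + s2) = h x" if "x \<in> X" for x
    by (rule bounded_harmonic_invariant[OF c(2,1,3) bd _ that]) (simp_all add: harm)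
  have c3: "x + of_int i *\<^sub>R (u + v) \<in> X" if "x \<in> X" for x i
    using cl'[OF that, of i i] by (simp add: algebra_simps)
  have c4: "x + of_int i *\<^sub>R (3 *\<^sub>R u) \<in> X" if "x \<in> X" for x i
    using cl[OF that, of "3 * i" 0] by (simp add: mult.commute)
  have p3: "h (x + 3 *\<^sub>R u) = h x" if "x \<in> X" for x
  proof -
    have y: "x + 3 *\<^sub>R u \<in> X" using c4[OF that, of 1] by simp
    have eq: "x + 3 *\<^sub>R u + s2 = x + s1" 
      using scaleR_left_distrib[of 1 2 u] by (simp add: s_defs algebra_simps)
    show ?thesis using p1[OF that] p2[OF y] unfolding eq by simp
  qed
  have P1: "h (x + of_int n *\<^sub>R (u + v)) = h x" if "x \<in> X" for x n
    using int_periodic[of X "u + v" h, OF c3 _ that] p1 by (simp add: s1_def)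
  have P3: "h (x + of_int n *\<^sub>R (3 *\<^sub>R u)) = h x" if "x \<in> X" for x n
    using int_periodic[of X "3 *\<^sub>R u" h x n] c4 p3 that by blast
  \<comment> \<open>Since iu + jv = (i - j)u + j(u + v), invariance under u + v and 3u leaves only i
    - j modulo 3.\<close>
  have red: "h (x + (of_int i' *\<^sub>R u + of_int j' *\<^sub>R v)) = h (x + of_int e *\<^sub>R u)"
    if "i' - j' = 3 * n + e" "x \<in> X" for i' j' n e x
  proof -
    have i': "i' = 3 * n + e + j'" using that by simp
    let ?y = "x + of_int e *\<^sub>R u"
    have y: "?y \<in> X" using cl[OF that(2), of e 0] by simp
    then have y': "?y + of_int n *\<^sub>R (3 *\<^sub>R u) \<in> X" using c4 by blast
    have "x + (of_int i' *\<^sub>R u + of_int j' *\<^sub>R v) = ?y + of_int n *\<^sub>R (3 *\<^sub>R u) + of_int j' *\<^sub>R (u + v)"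
      unfolding i' by (simp add: algebra_simps)
    then show ?thesis using P1[OF y', of j'] P3[OF y, of n] by metis
  qed
  have uv: "h (x + u) = h (x - v)"
    using p1[of "x - v"] cl[OF x, of 0 "-1"] by (simp add: s1_def algebra_simps)
  have "(i - j) mod 3 = 1 \<or> (i - j) mod 3 = 2" using ij by presburger
  then show ?thesis
  proof
    assume "(i - j) mod 3 = 1"
    then obtain n where n: "i - j = 3 * n + 1" by (metis mult_div_mod_eq)
    have "h (x + m) = h (x + u)" using red[OF n x] by (simp add: m_def)
    moreover have "h (x - m) = h (x - u)"
      using red[of "- i" "- j" "- n" "- 1", OF _ x] n by (simp add: m_def algebra_simps)
    ultimately show ?thesis using uv rel[OF x] by simp
  next
    assume "(i - j) mod 3 = 2"
    then have "(i - j) = 3 * ((i - j) div 3) + 2" by (metis mult_div_mod_eq)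
    then have n: "i - j = 3 * ((i - j) div 3 + 1) + -1" by simp
    have "h (x + m) = h (x - u)" using red[OF n x] by (simp add: m_def)
    moreover have "h (x - m) = h (x + u)"
      using red[of "- i" "- j" "- ((i - j) div 3 + 1)" 1, OF _ x] n by (simp add: m_def algebra_simps)
    ultimately show ?thesis using uv rel[OF x] by simp
  qed
qed

section \<open>Weak tilings by the unit cube\<close>

definition plus_measure :: "'a measure \<Rightarrow> 'a measure \<Rightarrow> 'a measure" where
  "plus_measure M N = measure_of (space M) (sets M) (\<lambda>A. emeasure M A + emeasure N A)"

lemma sets_plus_measure [simp, measurable_cong]: "sets (plus_measure M N) = sets M"
  by (simp add: plus_measure_def)

lemma emeasure_plus_measure:
  assumes "sets N = sets M" "A \<in> sets M"
  shows "emeasure (plus_measure M N) A = emeasure M A + emeasure N A"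
proof (rule emeasure_measure_of[OF plus_measure_def])
  show "sets M \<subseteq> Pow (space M)" by (rule sets.space_closed)
  show "A \<in> sets (plus_measure M N)" using assms by simp
  show "positive (sets (plus_measure M N)) (\<lambda>A. emeasure M A + emeasure N A)"
    by (simp add: positive_def)
  show "countably_additive (sets (plus_measure M N)) (\<lambda>A. emeasure M A + emeasure N A)"
  proof (rule countably_additiveI)
    fix B :: "nat \<Rightarrow> 'a set"
    assume B: "range B \<subseteq> sets (plus_measure M N)" "disjoint_family B"
    have "(\<Sum>i. emeasure M (B i) + emeasure N (B i)) = (\<Sum>i. emeasure M (B i)) + (\<Sum>i. emeasure N (B i))"
      by (rule suminf_add[symmetric]) auto
    also have "\<dots> = emeasure M (\<Union>i. B i) + emeasure N (\<Union>i. B i)"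
      using B assms by (simp add: suminf_emeasure)
    finally show "(\<Sum>i. emeasure M (B i) + emeasure N (B i)) = emeasure M (\<Union>i. B i) + emeasure N (\<Union>i. B i)" .
  qed
qed

section \<open>Half-open unit boxes as limits of open ones\<close>

definition half_open :: "bool \<Rightarrow> real \<Rightarrow> real set" where
  "half_open s t = (if s then {t..<t+1} else {t<..t+1})"

text \<open>The set \<open>S\<close> lists the axes on which the lower face is included instead of
  the upper one. Changing the choice on one axis exchanges two opposite facets and nothing else;
  this is how facets become measurable against each other.\<close>

definition hbox :: "'a::euclidean_space set \<Rightarrow> 'a \<Rightarrow> 'a set" where
  "hbox S p = {x. \<forall>i\<in>Basis. x \<bullet> i \<in> half_open (i \<in> S) (p \<bullet> i)}"

text \<open>A facet, orthogonal to \<open>i\<close>, of a half-open box. Whether \<open>i\<close>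
  belongs to \<open>S\<close> does not affect it, so boxes with either convention on axis
  \<open>i\<close> share these facets.\<close>

definition hcol :: "'a::euclidean_space set \<Rightarrow> 'a \<Rightarrow> 'a \<Rightarrow> 'a set" where
  "hcol S i p = {x. x \<bullet> i = p \<bullet> i \<and> (\<forall>j\<in>Basis - {i}. x \<bullet> j \<in> half_open (j \<in> S) (p \<bullet> j))}"

lemma half_open_borel [measurable]: "half_open s t \<in> sets borel"
  by (simp add: half_open_def)

lemma hbox_borel [measurable]: "hbox S p \<in> sets borel"
  unfolding hbox_def by measurable

lemma hcol_borel [measurable]: "hcol S i p \<in> sets borel"
  unfolding hcol_def by measurable

lemma finite_emeasure_bounded:
  fixes \<mu> :: "'a::euclidean_space measure"
  assumes lf: "locally_finite_borel_measure \<mu>" and "bounded B"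
  shows "emeasure \<mu> B < \<infinity>"
proof -
  have s: "sets \<mu> = sets borel" using lf by (simp add: locally_finite_borel_measure_def)
  obtain U where U: "\<And>x. open (U x) \<and> x \<in> U x \<and> emeasure \<mu> (U x) < \<infinity>"
    using lf unfolding locally_finite_borel_measure_def by metis
  have "compact (closure B)" using \<open>bounded B\<close> by simp
  then obtain X where X: "finite X" "closure B \<subseteq> (\<Union>x\<in>X. U x)"
    using U by (elim compactE_image[where C = "closure B" and f = U]) blast+
  have "emeasure \<mu> B \<le> emeasure \<mu> (\<Union>x\<in>X. U x)"
    using X closure_subset[of B] U s by (intro emeasure_mono) auto
  also have "\<dots> \<le> (\<Sum>x\<in>X. emeasure \<mu> (U x))"
    using X U s by (intro emeasure_subadditive_finite) auto
  also have "\<dots> < \<infinity>" using U X(1) by (simp add: ennreal_sum_less_top)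
  finally show ?thesis .
qed

lemma AE_lebesgue_ex_in_open:
  fixes U :: "'a::euclidean_space set"
  assumes "AE x in lebesgue. P x" "open U" "U \<noteq> {}"
  obtains x where "x \<in> U" "P x"
proof -
  obtain N where N: "negligible N" "{x. \<not> P x} \<subseteq> N"
    using assms(1) unfolding eventually_ae_filter negligible_iff_null_sets by auto
  have "\<not> negligible U" using assms open_not_negligible by blast
  then have "\<not> U \<subseteq> N" using N negligible_subset by blast
  then show ?thesis using that N by blast
qed

text \<open>The half-open boxes are limits of open boxes from the full-measure set of positions.\<close>

lemma hbox_emeasure_1:
  fixes \<omega> :: "'a::euclidean_space measure"
  assumes lf: "locally_finite_borel_measure \<omega>"
    and ae: "AE x in lebesgue. emeasure \<omega> (box (x - One) x) = 1"
  shows "emeasure \<omega> (hbox S p) = 1"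
proof -
  have s [simp]: "sets \<omega> = sets borel" using lf by (simp add: locally_finite_borel_measure_def)
  \<comment> \<open>The upper corner of the open box approaches p + One from below on the axes in
    \<open>S\<close>, which keeps the lower face and drops the upper one, and from above on the
    other axes.\<close>
  define sg where "sg = (\<Sum>i\<in>Basis. (if i \<in> S then -1 else 1) *\<^sub>R i :: 'a)"
  have sg: "sg \<bullet> i = (if i \<in> S then -1 else 1)" if "i \<in> Basis" for i
    using that by (simp add: sg_def)
  define r where "r n = 1 / real (Suc n)" for n
  have r: "0 < r n" "r n \<le> 1" for n by (simp_all add: r_def)
  \<comment> \<open>The offset \<open>r n\<close> is twice the radius of the neighbourhood searched
    for a generic corner, so the corner found lies strictly on the prescribed side of p +
    One.\<close>
  define c where "c n = p + One + r n *\<^sub>R sg" for n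
  have "\<forall>n. \<exists>x. x \<in> box (c n - (r n / 2) *\<^sub>R One) (c n + (r n / 2) *\<^sub>R One) \<and> emeasure \<omega> (box (x - One) x) = 1"
  proof
    fix n
    have "box (c n - (r n / 2) *\<^sub>R One) (c n + (r n / 2) *\<^sub>R One) \<noteq> {}"
      using r(1)[of n] by (simp add: box_ne_empty inner_diff_left inner_add_left)
    then show "\<exists>x. x \<in> box (c n - (r n / 2) *\<^sub>R One) (c n + (r n / 2) *\<^sub>R One) \<and> emeasure \<omega> (box (x - One) x) = 1"
      using AE_lebesgue_ex_in_open[OF ae open_box] by blast
  qed
  from choice[OF this] obtain x where
    x': "\<forall>n. x n \<in> box (c n - (r n / 2) *\<^sub>R One) (c n + (r n / 2) *\<^sub>R One) \<and> emeasure \<omega> (box (x n - One) (x n)) = 1" ..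
  have x: "x n \<in> box (c n - (r n / 2) *\<^sub>R One) (c n + (r n / 2) *\<^sub>R One)"
    "emeasure \<omega> (box (x n - One) (x n)) = 1" for n using x' by blast+
  define d where "d n i = x n \<bullet> i - (p \<bullet> i + 1)" for n i
  have d: "if i \<in> S then d n i < 0 \<and> d n i > - 2 * r n else d n i > 0 \<and> d n i < 2 * r n"
    if i: "i \<in> Basis" for n i
  proof -
    have "c n \<bullet> i - r n / 2 < x n \<bullet> i" "x n \<bullet> i < c n \<bullet> i + r n / 2"
      using x(1)[of n] i by (simp_all add: mem_box inner_diff_left inner_add_left)
    moreover have "c n \<bullet> i = p \<bullet> i + 1 + (if i \<in> S then - r n else r n)"
      using i sg by (simp add: c_def inner_add_left)
    ultimately show ?thesis using r(1)[of n] by (cases "i \<in> S") (simp_all add: d_def)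
  qed
  have small: "\<forall>\<^sub>F n in sequentially. 2 * r n < t" if "t > 0" for t :: real
  proof -
    have "(\<lambda>n. 2 * r n) \<longlonglongrightarrow> 0"
      using tendsto_mult_right_zero[OF LIMSEQ_inverse_real_of_nat, of 2]
      by (simp add: r_def inverse_eq_divide)
    then show ?thesis using that order_tendstoD(2) by blast
  qed
  have ev: "\<forall>\<^sub>F n in sequentially. y \<in> box (x n - One) (x n) \<longleftrightarrow> y \<in> hbox S p" for y
  proof -
    have "\<forall>\<^sub>F n in sequentially. (x n \<bullet> i - 1 < y \<bullet> i \<and> y \<bullet> i < x n \<bullet> i) \<longleftrightarrow> y \<bullet> i \<in> half_open (i \<in> S) (p \<bullet> i)"
      if i: "i \<in> Basis" for i
    proof -
      define t where "t = y \<bullet> i - p \<bullet> i"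
      \<comment> \<open>Once the offset is below \<delta>, only a point exactly on a face can be
        affected by it, and there its sign decides.\<close>
      obtain \<delta> where \<delta>: "\<delta> > 0" "t \<noteq> 0 \<Longrightarrow> \<delta> \<le> \<bar>t\<bar>" "t \<noteq> 1 \<Longrightarrow> \<delta> \<le> \<bar>t - 1\<bar>" 
      proof
        let ?r = "min (if t = 0 then 1 else \<bar>t\<bar>) (if t = 1 then 1 else \<bar>t - 1\<bar>)"
        show "?r > 0" "t \<noteq> 0 \<Longrightarrow> ?r \<le> \<bar>t\<bar>" "t \<noteq> 1 \<Longrightarrow> ?r \<le> \<bar>t - 1\<bar>" by auto
      qed
      show ?thesis
        using small[OF \<delta>(1)]
      proof eventually_elim
        case (elim n)
        have t: "t = 0 \<or> \<delta> \<le> \<bar>t\<bar>" "t = 1 \<or> \<delta> \<le> \<bar>t - 1\<bar>" using \<delta> by auto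
        show ?case
        proof (cases "i \<in> S")
          case True
          then have "d n i < 0" "- \<delta> < d n i" using d[OF i, of n] elim by auto
          with t \<delta>(1) have "(d n i < t \<and> t < d n i + 1) \<longleftrightarrow> (0 \<le> t \<and> t < 1)" by linarith
          then show ?thesis using True by (simp add: half_open_def d_def t_def algebra_simps)
        next
          case False
          then have "0 < d n i" "d n i < \<delta>" using d[OF i, of n] elim by auto
          with t \<delta>(1) have "(d n i < t \<and> t < d n i + 1) \<longleftrightarrow> (0 < t \<and> t \<le> 1)" by linarith
          then show ?thesis using False by (simp add: half_open_def d_def t_def algebra_simps)
        qed
      qed
    qed
    then have "\<forall>\<^sub>F n in sequentially. \<forall>i\<in>Basis. (x n \<bullet> i - 1 < y \<bullet> i \<and> y \<bullet> i < x n \<bullet> i) \<longleftrightarrow> y \<bullet> i \<in> half_open (i \<in> S) (p \<bullet> i)"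
      by (simp add: eventually_ball_finite)
    then show ?thesis
      by eventually_elim (auto simp: mem_box hbox_def inner_diff_left)
  qed
  define W where "W = cbox (p - 4 *\<^sub>R One) (p + 4 *\<^sub>R One)"
  have W: "box (x n - One) (x n) \<subseteq> W" for n
  proof
    fix y assume y: "y \<in> box (x n - One) (x n)"
    have "p \<bullet> i - 4 \<le> y \<bullet> i \<and> y \<bullet> i \<le> p \<bullet> i + 4" if i: "i \<in> Basis" for i
    proof -
      have "\<bar>d n i\<bar> \<le> 2" using d[OF i, of n] r(2)[of n] by (simp split: if_splits)
      moreover have "x n \<bullet> i - 1 < y \<bullet> i" "y \<bullet> i < x n \<bullet> i" using y i by (auto simp: mem_box inner_diff_left)
      ultimately show ?thesis unfolding d_def by linarith
    qed
    then show "y \<in> W" by (simp add: W_def mem_box inner_diff_left inner_add_left)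
  qed
  have "(\<lambda>n. \<integral>\<^sup>+ y. indicator (box (x n - One) (x n)) y \<partial>\<omega>) \<longlonglongrightarrow> (\<integral>\<^sup>+ y. indicator (hbox S p) y \<partial>\<omega>)"
  proof (rule nn_integral_dominated_convergence[where w = "indicator W"])
    show "(\<integral>\<^sup>+ y. indicator W y \<partial>\<omega>) < \<infinity>"
      using finite_emeasure_bounded[OF lf, of W] by (simp add: W_def)
    show "AE y in \<omega>. (\<lambda>n. indicator (box (x n - One) (x n)) y :: ennreal) \<longlonglongrightarrow> indicator (hbox S p) y"
    proof (rule AE_I2)
      fix y
      show "(\<lambda>n. indicator (box (x n - One) (x n)) y :: ennreal) \<longlonglongrightarrow> indicator (hbox S p) y"
        by (rule tendsto_eventually, rule eventually_mono[OF ev[of y]]) (simp add: indicator_def)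
    qed
    show "AE y in \<omega>. indicator (box (x n - One) (x n)) y \<le> (indicator W y :: ennreal)" for n
      using W[of n] by (auto simp: indicator_def)
  qed (simp_all add: borel_measurable_indicator_iff W_def)
  then have "(\<lambda>n. 1) \<longlonglongrightarrow> emeasure \<omega> (hbox S p)"
    using x(2) by simp
  then show ?thesis by (simp add: LIMSEQ_const_iff)
qed

section \<open>Columns and atoms of a measure with unit mass on all half-open boxes\<close>

locale unit_box_mass =
  fixes \<omega> :: "'a::euclidean_space measure"
  assumes borel [simp, measurable_cong]: "sets \<omega> = sets borel"
    and hbox_mass: "\<And>S p. emeasure \<omega> (hbox S p) = 1"
begin

lemma measure_hbox: "measure \<omega> (hbox S p) = 1"
  by (simp add: measure_def hbox_mass)

lemma fmeasurable_subset_hbox: "A \<subseteq> hbox S p \<Longrightarrow> A \<in> sets borel \<Longrightarrow> A \<in> fmeasurable \<omega>"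
  by (rule fmeasurableI2[of "hbox S p"]) (auto intro!: fmeasurableI simp: hbox_mass)

lemma hcol_subset_hbox: "(i::'a) \<in> Basis \<Longrightarrow> hcol S i p \<subseteq> hbox (insert i S) p"
  unfolding hcol_def hbox_def
proof safe
  fix x j :: 'a assume "x \<bullet> i = p \<bullet> i" "\<forall>j\<in>Basis - {i}. x \<bullet> j \<in> half_open (j \<in> S) (p \<bullet> j)" "j \<in> Basis"
  then show "x \<bullet> j \<in> half_open (j \<in> insert i S) (p \<bullet> j)"
    by (cases "j = i") (simp_all add: half_open_def)
qed

lemma fmeasurable_hcol: "i \<in> Basis \<Longrightarrow> hcol S i p \<in> fmeasurable \<omega>"
  by (rule fmeasurable_subset_hbox[OF hcol_subset_hbox]) simp_all

lemma fmeasurable_singleton: "{p} \<in> fmeasurable \<omega>"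
  by (rule fmeasurable_subset_hbox[of _ UNIV p]) (auto simp: hbox_def half_open_def)

lemma measure_Un_disjoint:
  "A \<in> fmeasurable \<omega> \<Longrightarrow> B \<in> fmeasurable \<omega> \<Longrightarrow> A \<inter> B = {} \<Longrightarrow>
    measure \<omega> (A \<union> B) = measure \<omega> A + measure \<omega> B"
  by (rule measure_Un_AE) auto

text \<open>Two boxes at the same position, with opposite conventions on axis \<open>i\<close>, have
  the part \<open>Mid\<close> in common and differ only in which of the two opposite facets they
  contain. Both have mass 1.\<close>

lemma measure_hcol_shift1:
  assumes i: "i \<in> Basis"
  shows "measure \<omega> (hcol S i (p + i)) = measure \<omega> (hcol S i p)"
proof -
  define Mid where "Mid = {x. p \<bullet> i < x \<bullet> i \<and> x \<bullet> i < p \<bullet> i + 1 \<and> (\<forall>j\<in>Basis - {i}. x \<bullet> j \<in> half_open (j \<in> S) (p \<bullet> j))}"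
  have pj: "(p + i) \<bullet> j = p \<bullet> j" if "j \<in> Basis - {i}" for j
    using that i by (auto simp: inner_add_left inner_Basis)
  have pi: "(p + i) \<bullet> i = p \<bullet> i + 1" using i by (simp add: inner_add_left)
  have split: "(\<forall>j\<in>Basis. Q j) \<longleftrightarrow> Q i \<and> (\<forall>j\<in>Basis - {i}. Q j)" for Q
    using i by auto
  have 1: "hbox (insert i S) p = hcol S i p \<union> Mid" "hcol S i p \<inter> Mid = {}"
    unfolding hbox_def hcol_def Mid_def split by (auto simp: half_open_def)
  have 2: "hbox (S - {i}) p = hcol S i (p + i) \<union> Mid" "hcol S i (p + i) \<inter> Mid = {}"
    unfolding hbox_def hcol_def Mid_def split using pj pi by (auto simp: half_open_def)
  have [measurable]: "Mid \<in> sets borel" unfolding Mid_def by measurable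
  have fm: "Mid \<in> fmeasurable \<omega>"
    by (rule fmeasurable_subset_hbox[of _ "insert i S" p]) (use 1 in auto)
  have "measure \<omega> (hcol S i p) + measure \<omega> Mid = 1"
    using measure_Un_disjoint[OF fmeasurable_hcol[OF i] fm 1(2)] measure_hbox[of "insert i S" p]
    by (simp add: 1(1))
  moreover have "measure \<omega> (hcol S i (p + i)) + measure \<omega> Mid = 1"
    using measure_Un_disjoint[OF fmeasurable_hcol[OF i] fm 2(2)] measure_hbox[of "S - {i}" p]
    by (simp add: 2(1))
  ultimately show ?thesis by simp
qed

lemma int_shift_invariant:
  fixes F :: "'a \<Rightarrow> real"
  assumes "\<And>p. F (p + i) = F p"
  shows "F (p + of_int n *\<^sub>R i) = F p"
  using int_periodic[of UNIV i F p n] assms by simp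

lemma measure_hcol_shift:
  assumes i: "i \<in> Basis"
  shows "measure \<omega> (hcol S i (p + of_int n *\<^sub>R i)) = measure \<omega> (hcol S i p)"
  by (rule int_shift_invariant[of "\<lambda>p. measure \<omega> (hcol S i p)", OF measure_hcol_shift1[OF i]])

text \<open>Integer shifts along \<open>i\<close> preserve the mass of a facet. If the difference
  were not an integer, the facet through \<open>p\<close> could be moved strictly between the two
  opposite faces of a box whose lower facet contains \<open>q\<close>. That facet already has mass
  1, leaving nothing for the positive mass brought in by \<open>p\<close>.\<close>

lemma atom_column_integer:
  assumes i: "i \<in> Basis" and q: "measure \<omega> {q} \<ge> 1" and p: "measure \<omega> {p} > 0"
    and close: "\<And>j. j \<in> Basis - {i} \<Longrightarrow> \<bar>p \<bullet> j - q \<bullet> j\<bar> < 1"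
  shows "p \<bullet> i - q \<bullet> i \<in> \<int>"
proof (rule ccontr)
  assume nint: "p \<bullet> i - q \<bullet> i \<notin> \<int>"
  \<comment> \<open>With minima in the coordinates other than \<open>i\<close>, both points fall
    into the half-open cross-section at \<open>r\<close>; this uses that they are less than 1 apart
    there.\<close>
  define r where "r = (\<Sum>j\<in>Basis. (if j = i then q \<bullet> i else min (p \<bullet> j) (q \<bullet> j)) *\<^sub>R j)"
  have r: "r \<bullet> j = (if j = i then q \<bullet> i else min (p \<bullet> j) (q \<bullet> j))" if "j \<in> Basis" for j
    using that by (simp add: r_def)
  define \<theta> where "\<theta> = frac (p \<bullet> i - q \<bullet> i)"
  have \<theta>: "0 < \<theta>" "\<theta> < 1"
    using nint by (auto simp: \<theta>_def frac_lt_1 frac_gt_0_iff)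
  define r1 where "r1 = r + \<theta> *\<^sub>R i"
  have r1: "r1 \<bullet> j = (if j = i then q \<bullet> i + \<theta> else r \<bullet> j)" if "j \<in> Basis" for j
    using that i r by (simp add: r1_def inner_add_left inner_Basis)
  define r2 where "r2 = r1 + of_int \<lfloor>p \<bullet> i - q \<bullet> i\<rfloor> *\<^sub>R i"
  have r2: "r2 \<bullet> j = (if j = i then p \<bullet> i else r \<bullet> j)" if "j \<in> Basis" for j
    using that i r r1 by (simp add: r2_def inner_add_left inner_not_same_Basis \<theta>_def frac_def)
  have mon: "measure \<omega> {x} \<le> measure \<omega> (hcol UNIV i y)" if "x \<in> hcol UNIV i y" for x y
    using that fmeasurable_hcol[OF i] by (intro measure_mono_fmeasurable) auto
  have "q \<in> hcol UNIV i r" "p \<in> hcol UNIV i r2"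
    using close r r2 i by (fastforce simp: hcol_def half_open_def min_def abs_less_iff)+
  then have "1 \<le> measure \<omega> (hcol UNIV i r)" "0 < measure \<omega> (hcol UNIV i r2)"
    using mon q p by force+
  moreover have "measure \<omega> (hcol UNIV i r2) = measure \<omega> (hcol UNIV i r1)"
    unfolding r2_def using measure_hcol_shift[OF i] .
  moreover have "measure \<omega> (hcol UNIV i r) + measure \<omega> (hcol UNIV i r1) \<le> 1"
  proof -
    have "measure \<omega> (hcol UNIV i r) + measure \<omega> (hcol UNIV i r1) = measure \<omega> (hcol UNIV i r \<union> hcol UNIV i r1)"
      using \<theta> r r1 i
      by (intro measure_Un_disjoint[symmetric] fmeasurable_hcol) (auto simp: hcol_def)
    also have "\<dots> \<le> measure \<omega> (hbox UNIV r)"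
    proof (rule measure_mono_fmeasurable)
      have "hcol UNIV i r1 \<subseteq> hbox UNIV r"
      proof
        fix x assume x: "x \<in> hcol UNIV i r1"
        have "x \<bullet> j \<in> half_open True (r \<bullet> j)" if "j \<in> Basis" for j
        proof (cases "j = i")
          case True
          then show ?thesis using x \<theta> r[OF i] r1[OF i] by (simp add: hcol_def half_open_def)
        next
          case False
          then have "x \<bullet> j \<in> half_open True (r1 \<bullet> j)" using x that by (simp add: hcol_def)
          then show ?thesis using r1[OF that] False by simp
        qed
        then show "x \<in> hbox UNIV r" by (simp add: hbox_def)
      qed
      then show "hcol UNIV i r \<union> hcol UNIV i r1 \<subseteq> hbox UNIV r"
        using hcol_subset_hbox[OF i, of UNIV r] by simp
    qed (auto intro!: fmeasurableI simp: hbox_mass)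
    finally show ?thesis by (simp add: measure_hbox)
  qed
  ultimately show False by linarith
qed

text \<open>In the plane a facet orthogonal to \<open>e\<close> is a segment in direction
  \<open>g\<close>. Its versions closed at the lower and at the upper end differ in \<open>p\<close>
  and \<open>p + g\<close>, so the difference of these two atoms is a difference of facet masses,
  which is invariant under integer shifts along \<open>e\<close>.\<close>

lemma atom_four_point:
  assumes B: "Basis = {e, g}" "e \<noteq> g"
  shows "measure \<omega> {p + of_int n *\<^sub>R e + of_int k *\<^sub>R g} - measure \<omega> {p + of_int k *\<^sub>R g}
       = measure \<omega> {p + of_int n *\<^sub>R e} - measure \<omega> {p}"
proof -
  have e: "e \<in> Basis" and g: "g \<in> Basis" using B by auto
  have ge: "g \<bullet> e = 0" "e \<bullet> g = 0" using e g B by (simp_all add: inner_Basis)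
  have eq: "x = y" if "x \<bullet> e = y \<bullet> e" "x \<bullet> g = y \<bullet> g" for x y
  proof (rule euclidean_eqI)
    fix b :: 'a assume "b \<in> Basis"
    then have "b = e \<or> b = g" using B by blast
    then show "x \<bullet> b = y \<bullet> b" using that by blast
  qed
  have step: "measure \<omega> (hcol UNIV e p) + measure \<omega> {p + g} = measure \<omega> (hcol {} e p) + measure \<omega> {p}" for p
  proof -
    have "measure \<omega> (hcol UNIV e p) + measure \<omega> {p + g} = measure \<omega> (hcol UNIV e p \<union> {p + g})"
    proof (rule measure_Un_disjoint[OF fmeasurable_hcol[OF e] fmeasurable_singleton, symmetric])
      have "g \<in> Basis - {e}" using B by auto
      then show "hcol UNIV e p \<inter> {p + g} = {}"
        using g by (force simp: hcol_def half_open_def inner_add_left)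
    qed
    also have "hcol UNIV e p \<union> {p + g} = hcol {} e p \<union> {p}"
    proof (intro set_eqI)
      fix x
      have 1: "x = p + g \<longleftrightarrow> x \<bullet> e = p \<bullet> e \<and> x \<bullet> g = p \<bullet> g + 1"
        using eq[of x "p + g"] g ge by (auto simp: inner_add_left)
      have 2: "x = p \<longleftrightarrow> x \<bullet> e = p \<bullet> e \<and> x \<bullet> g = p \<bullet> g" using eq by auto
      have 3: "Basis - {e} = {g}" using B by auto
      show "x \<in> hcol UNIV e p \<union> {p + g} \<longleftrightarrow> x \<in> hcol {} e p \<union> {p}"
        unfolding Un_iff singleton_iff 1 2 hcol_def mem_Collect_eq 3 by (auto simp: half_open_def)
    qed
    also have "measure \<omega> (hcol {} e p \<union> {p}) = measure \<omega> (hcol {} e p) + measure \<omega> {p}"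
    proof (rule measure_Un_disjoint[OF fmeasurable_hcol[OF e] fmeasurable_singleton])
      have "g \<in> Basis - {e}" using B by auto
      then show "hcol {} e p \<inter> {p} = {}"
        by (force simp: hcol_def half_open_def)
    qed
    finally show ?thesis .
  qed
  define F where "F p = measure \<omega> {p + of_int n *\<^sub>R e} - measure \<omega> {p}" for p
  have "F (p + g) = F p" for p
  proof -
    have "measure \<omega> {p + g + of_int n *\<^sub>R e} - measure \<omega> {p + of_int n *\<^sub>R e} = measure \<omega> {p + g} - measure \<omega> {p}"
      using step[of p] step[of "p + of_int n *\<^sub>R e"] measure_hcol_shift[OF e, of UNIV p n] measure_hcol_shift[OF e, of "{}" p n]
      by (simp add: add_ac)
    then show ?thesis by (simp add: F_def)
  qed
  from int_shift_invariant[of F g, OF this, of p k] show ?thesis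
    by (simp add: F_def add_ac)
qed

text \<open>A weak form of Keller's theorem on cube tilings.\<close>

lemma atoms_nonzero_integer_coordinate:
  assumes dim: "DIM('a) \<in> {1, 2}" and z: "measure \<omega> {0} \<ge> 1" and m: "measure \<omega> {m} \<ge> 1" "m \<noteq> 0"
  shows "\<exists>i\<in>Basis. m \<bullet> i \<in> \<int> \<and> m \<bullet> i \<noteq> 0"
proof (cases "DIM('a) = 1")
  case True
  then obtain i :: 'a where B: "Basis = {i}" by (auto simp: card_1_singleton_iff)
  have "m \<bullet> i - 0 \<bullet> i \<in> \<int>"
    by (rule atom_column_integer) (use B z m in auto)
  moreover have "m \<bullet> i \<noteq> 0"
  proof
    assume "m \<bullet> i = 0"
    then have "m = 0" by - (rule euclidean_eqI, unfold B, simp)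
    with m(2) show False ..
  qed
  ultimately show ?thesis using B by auto
next
  case False
  then have "DIM('a) = 2" using dim by simp
  then obtain e g :: 'a where B: "Basis = {e, g}" "e \<noteq> g" by (auto simp: card_2_iff)
  have eg: "e \<in> Basis" "g \<in> Basis" using B by auto
  have orth: "e \<bullet> g = 0" "g \<bullet> e = 0" "e \<bullet> e = 1" "g \<bullet> g = 1"
    using B(2) by (auto simp: inner_Basis[OF eg] inner_Basis[OF eg(2,1)] inner_Basis[OF eg(1,1)] inner_Basis[OF eg(2,2)])
  have col_e: "p \<bullet> e - q \<bullet> e \<in> \<int>"
    if "measure \<omega> {q} \<ge> 1" "measure \<omega> {p} > 0" "\<bar>p \<bullet> g - q \<bullet> g\<bar> < 1" for p q
    by (rule atom_column_integer) (use B that in auto)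
  have col_g: "p \<bullet> g - q \<bullet> g \<in> \<int>"
    if "measure \<omega> {q} \<ge> 1" "measure \<omega> {p} > 0" "\<bar>p \<bullet> e - q \<bullet> e\<bar> < 1" for p q
    by (rule atom_column_integer) (use B that in auto)
  have nz: "m \<bullet> e \<noteq> 0 \<or> m \<bullet> g \<noteq> 0" 
  proof (rule ccontr)
    assume "\<not> ?thesis"
    then have "m = 0" by - (rule euclidean_eqI, unfold B, auto)
    with m(2) show False ..
  qed
  consider "m \<bullet> e = 0" | "m \<bullet> g = 0" | "m \<bullet> e \<noteq> 0" "m \<bullet> g \<noteq> 0" by blast
  then show ?thesis
  proof cases
    case 1
    then show ?thesis using col_g[of 0 m] z m nz B by auto
  next
    case 2
    then show ?thesis using col_e[of 0 m] z m nz B by auto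
  next
    case 3
    have "m \<bullet> e \<in> \<int> \<or> m \<bullet> g \<in> \<int>"
    proof (rule ccontr)
      assume "\<not> ?thesis"
      then have ni: "m \<bullet> e \<notin> \<int>" "m \<bullet> g \<notin> \<int>" by auto
      \<comment> \<open>The four-point relation at the corners 0, ne, kg, ne + kg forces positive
        mass at ne or kg because 0 carries mass at least 1. Rounding down puts ne within distance 1
        of \<open>m\<close> in the e-coordinate, so comparing it with the atom at \<open>m\<close>
        makes m \<bullet> g an integer; likewise for kg.\<close>
      define n k where "n = \<lfloor>m \<bullet> e\<rfloor>" and "k = \<lfloor>m \<bullet> g\<rfloor>"
      have "measure \<omega> {of_int n *\<^sub>R e + of_int k *\<^sub>R g} + measure \<omega> {0}
          = measure \<omega> {of_int n *\<^sub>R e} + measure \<omega> {of_int k *\<^sub>R g}"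
        using atom_four_point[OF B, of 0 n k] by simp
      moreover have "measure \<omega> {of_int n *\<^sub>R e + of_int k *\<^sub>R g} \<ge> 0" by simp
      ultimately have "measure \<omega> {of_int n *\<^sub>R e} > 0 \<or> measure \<omega> {of_int k *\<^sub>R g} > 0"
        using z by linarith
      then show False
      proof
        assume "measure \<omega> {of_int n *\<^sub>R e} > 0"
        moreover have "\<bar>of_int n - m \<bullet> e\<bar> < 1" unfolding n_def by linarith
        ultimately show False using col_g[of m "of_int n *\<^sub>R e"] m ni orth by simp
      next
        assume "measure \<omega> {of_int k *\<^sub>R g} > 0"
        moreover have "\<bar>of_int k - m \<bullet> g\<bar> < 1" unfolding k_def by linarith
        ultimately show False using col_e[of m "of_int k *\<^sub>R g"] m ni orth by simp
      qed
    qed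
    then show ?thesis using 3 B by auto
  qed
qed

end

section \<open>The group generated by the translations\<close>

lemma mod3_cases: "x mod 3 = 0 \<or> x mod 3 = 1 \<or> x mod 3 = (2::int)"
  by presburger

lemma mod3_minus:
  "x mod 3 \<noteq> 0 \<Longrightarrow> y mod 3 \<noteq> 0 \<Longrightarrow> y mod 3 \<noteq> x mod 3 \<Longrightarrow> (- y) mod 3 = x mod (3::int)"
  using mod3_cases[of x] mod3_cases[of y] by (auto simp: zmod_zminus1_eq_if)

lemma mod3_add: "x mod 3 \<noteq> 0 \<Longrightarrow> y mod 3 = x mod 3 \<Longrightarrow> (x + y) mod 3 \<noteq> (0::int)"
  using mod3_cases[of x] mod_add_eq[of x 3 y] by auto

lemma mod3_opposite_signs:
  assumes "x mod 3 \<noteq> 0" "x mod 3 = y mod 3" "s = 1 \<or> s = (- 1 :: int)"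
  shows "(s * y) mod 3 \<noteq> 0" "(- s * x) mod 3 \<noteq> 0" "(s * y) mod 3 \<noteq> (- s * x) mod 3"
proof -
  have "x mod 3 = 1 \<or> x mod 3 = 2" using assms(1) mod3_cases by blast
  then show "(s * y) mod 3 \<noteq> 0" "(- s * x) mod 3 \<noteq> 0" "(s * y) mod 3 \<noteq> (- s * x) mod 3"
    using assms(2,3) by (auto simp: zmod_zminus1_eq_if)
qed

text \<open>A set of pairs closed under the sums in question cannot be covered by two subgroups unless one of them
  suffices: \<open>p + q\<close> escapes both if \<open>p\<close> escapes the first and \<open>q\<close> the second.\<close>

lemma integer_coordinate_uniform:
  fixes u v :: "'a::euclidean_space"
  assumes dim: "DIM('a) \<in> {1, 2}"
    and K: "\<And>i j :: int. (i - j) mod 3 \<noteq> 0 \<Longrightarrow>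
      \<exists>e\<in>Basis. (of_int i *\<^sub>R u + of_int j *\<^sub>R v) \<bullet> e \<in> \<int> \<and> (of_int i *\<^sub>R u + of_int j *\<^sub>R v) \<bullet> e \<noteq> 0"
  obtains e where "e \<in> Basis" "u \<bullet> e \<in> \<int>" "v \<bullet> e \<in> \<int>"
proof -
  define L :: "'a \<Rightarrow> int \<Rightarrow> int \<Rightarrow> real" where "L e i j = of_int i * (u \<bullet> e) + of_int j * (v \<bullet> e)" for e i j
  have K': "\<exists>e\<in>Basis. L e i j \<in> \<int>" if "(i - j) mod 3 \<noteq> 0" for i j
    using K[OF that] by (auto simp: L_def inner_add_left)
  have "\<exists>e\<in>Basis. \<forall>i j. (i - j) mod 3 \<noteq> 0 \<longrightarrow> L e i j \<in> \<int>"
  proof (cases "DIM('a) = 1")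
    case True
    then obtain e :: 'a where B: "Basis = {e}" by (auto simp: card_1_singleton_iff)
    have "L e i j \<in> \<int>" if "(i - j) mod 3 \<noteq> 0" for i j using K'[OF that] unfolding B by blast
    then show ?thesis unfolding B by blast
  next
    case False
    then have "DIM('a) = 2" using dim by simp
    then obtain e g :: 'a where B: "Basis = {e, g}" "e \<noteq> g" by (auto simp: card_2_iff)
    have add: "L b (i + i') (j + j') = L b i j + L b i' j'" for b i j i' j'
      by (simp add: L_def algebra_simps)
    have neg: "L b (- i) (- j) = - L b i j" for b i j by (simp add: L_def)
    show ?thesis
    proof (rule ccontr)
      assume "\<not> ?thesis"
      then obtain i j i' j' where p: "(i - j) mod 3 \<noteq> 0" "L e i j \<notin> \<int>"
        and q: "(i' - j') mod 3 \<noteq> 0" "L g i' j' \<notin> \<int>" unfolding B(1) by blast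
      \<comment> \<open>The second pair is negated if necessary to share the residue r of the first;
        the sum then has residue 2r, which is nonzero, so the hypothesis applies to it.\<close>
      obtain i'' j'' where q'': "(i'' - j'') mod 3 = (i - j) mod 3" "L g i'' j'' \<notin> \<int>"
      proof (cases "(i' - j') mod 3 = (i - j) mod 3")
        case True then show ?thesis using that q by blast
      next
        case False
        then have "(- (i' - j')) mod 3 = (i - j) mod 3" using mod3_minus p(1) q(1) by blast
        then have "(- i' - (- j')) mod 3 = (i - j) mod 3" by simp
        then show ?thesis using that[of "- i'" "- j'"] q neg by (simp add: Ints_minus)
      qed
      then have "(i'' - j'') mod 3 \<noteq> 0" using p(1) by simp
      then have e: "L e i'' j'' \<in> \<int>" using K' q''(2) unfolding B(1) by blast
      have g: "L g i j \<in> \<int>" using K' p unfolding B(1) by blast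
      have "((i - j) + (i'' - j'')) mod 3 \<noteq> 0" using mod3_add[OF p(1) q''(1)] .
      then have "((i + i'') - (j + j'')) mod 3 \<noteq> 0" by (simp add: algebra_simps)
      then have "L e (i + i'') (j + j'') \<in> \<int> \<or> L g (i + i'') (j + j'') \<in> \<int>" using K' unfolding B(1) by blast
      then show False
        using e g p(2) q''(2) unfolding add by (metis Ints_diff add_diff_cancel_left' add_diff_cancel_right')
    qed
  qed
  then obtain e where e: "e \<in> Basis" "\<And>i j. (i - j) mod 3 \<noteq> 0 \<Longrightarrow> L e i j \<in> \<int>" by blast
  have "u \<bullet> e \<in> \<int>" "v \<bullet> e \<in> \<int>"
    using e(2)[of 1 0] e(2)[of 0 1] by (simp_all add: L_def)
  with e(1) show thesis using that by blast
qed

lemma coprime_decomposition: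
  fixes m n :: int
  assumes "m \<noteq> 0 \<or> n \<noteq> 0"
  obtains k p q :: int where "k > 0" "m = k * p" "n = k * q" "coprime p q"
proof -
  have "gcd m n \<noteq> 0" using assms by simp
  then obtain p q where "m = p * gcd m n" "n = q * gcd m n" "coprime p q"
    using gcd_coprime_exists by blast
  then show thesis
    using that[of "gcd m n" p q] \<open>gcd m n \<noteq> 0\<close> by (simp add: mult.commute order_less_le)
qed

text \<open>Bezout coefficients are determined up to multiples of \<open>(q, - p)\<close>, which leaves the freedom to
  prescribe their difference modulo 3 since \<open>p + q\<close> is invertible modulo 3.\<close>

lemma bezout_congruent_mod3:
  fixes p q :: int
  assumes "coprime p q" "(p + q) mod 3 \<noteq> 0"
  obtains \<alpha> \<beta> where "\<alpha> * p + \<beta> * q = 1" "\<alpha> mod 3 = \<beta> mod 3"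
proof -
  obtain \<alpha> \<beta> where ab: "\<alpha> * p + \<beta> * q = 1"
    using bezout_int[of p q] assms(1) by (auto simp: coprime_iff_gcd_eq_1)
  have "\<exists>n\<in>{0,1,2}. (\<alpha> - \<beta> + n * (p + q)) mod 3 = 0"
  proof -
    have "(\<alpha> - \<beta> + 0 * (p + q)) mod 3 = 0 \<or> (\<alpha> - \<beta> + 1 * (p + q)) mod 3 = 0 \<or> (\<alpha> - \<beta> + 2 * (p + q)) mod 3 = 0"
      using assms(2) by presburger
    then show ?thesis by auto
  qed
  then obtain n where n: "(\<alpha> - \<beta> + n * (p + q)) mod 3 = 0" by (rule bexE)
  show thesis
  proof
    show "(\<alpha> + n * q) * p + (\<beta> - n * p) * q = 1" using ab by (simp add: algebra_simps)
    have "((\<alpha> + n * q) - (\<beta> - n * p)) mod 3 = 0" using n by (simp add: algebra_simps)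
    then show "(\<alpha> + n * q) mod 3 = (\<beta> - n * p) mod 3" by (simp add: mod_eq_dvd_iff mod_0_imp_dvd)
  qed
qed

text \<open>If 3 divided one of the two it would divide both; otherwise they are opposite nonzero
  residues.\<close>

lemma residues_of_orthogonal_pair:
  fixes p q :: int
  assumes "coprime p q" "(p + q) mod 3 = 0"
  shows "p mod 3 \<noteq> 0" "q mod 3 \<noteq> 0" "p mod 3 \<noteq> q mod 3"
proof -
  have "\<not> (3 dvd p \<and> 3 dvd q)" using assms(1) coprime_common_divisor_int[of p q 3] by auto
  then have "\<not> (p mod 3 = 0 \<and> q mod 3 = 0)" by auto
  then show "p mod 3 \<noteq> 0" "q mod 3 \<noteq> 0" "p mod 3 \<noteq> q mod 3" using assms(2) by presburger+
qed

text \<open>The normal form used for tiling and spectrality: up to the shear \<open>x \<mapsto> x - \<rho> (x \<bullet> g) e\<close>, absent when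
  \<open>g = 0\<close>, the \<open>e\<close>-coordinates of \<open>0, u, v\<close> are \<open>N\<close> times a complete residue system modulo 3.\<close>

lemma lattice_normal_form:
  fixes u v :: "'a::euclidean_space"
  assumes dim: "DIM('a) \<in> {1, 2}"
    and K: "\<And>i j :: int. (i - j) mod 3 \<noteq> 0 \<Longrightarrow>
      \<exists>e\<in>Basis. (of_int i *\<^sub>R u + of_int j *\<^sub>R v) \<bullet> e \<in> \<int> \<and> (of_int i *\<^sub>R u + of_int j *\<^sub>R v) \<bullet> e \<noteq> 0"
  obtains e g :: 'a and \<rho> :: real and N \<beta> \<gamma> :: int where
    "e \<in> Basis" "g = 0 \<or> g \<in> Basis" "g \<noteq> e" "N > 0"
    "u \<bullet> g \<in> \<int>" "v \<bullet> g \<in> \<int>"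
    "u \<bullet> e - \<rho> * (u \<bullet> g) = of_int (N * \<beta>)" "v \<bullet> e - \<rho> * (v \<bullet> g) = of_int (N * \<gamma>)"
    "\<beta> mod 3 \<noteq> 0" "\<gamma> mod 3 \<noteq> 0" "\<beta> mod 3 \<noteq> \<gamma> mod 3"
proof -
  note normal_form = that
  define L :: "'a \<Rightarrow> int \<Rightarrow> int \<Rightarrow> real" where "L e i j = of_int i * (u \<bullet> e) + of_int j * (v \<bullet> e)" for e i j
  have K': "\<exists>e\<in>Basis. L e i j \<in> \<int> \<and> L e i j \<noteq> 0" if "(i - j) mod 3 \<noteq> 0" for i j
    using K[OF that] by (simp add: L_def inner_add_left)
  \<comment> \<open>A single axis that serves all admissible combinations already gives the normal
    form, with g = 0 and \<rho> = 0.\<close>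
  have noshear: thesis
    if e: "e \<in> Basis" "u \<bullet> e \<in> \<int>" "v \<bullet> e \<in> \<int>" and nz: "\<And>i j. (i - j) mod 3 \<noteq> 0 \<Longrightarrow> L e i j \<noteq> 0" for e
  proof -
    obtain m n :: int where mn: "u \<bullet> e = of_int m" "v \<bullet> e = of_int n"
      using e by (auto elim!: Ints_cases)
    have "m \<noteq> 0" using nz[of 1 0] mn by (simp add: L_def)
    then obtain k p q where k: "k > 0" "m = k * p" "n = k * q" "coprime p q"
      using coprime_decomposition by blast
    \<comment> \<open>A combination with vanishing e-coordinate cannot be admissible, so its index
      difference p + q is divisible by 3.\<close>
    have "L e q (- p) = 0" by (simp add: L_def mn k algebra_simps)
    then have "(q - - p) mod 3 = 0" using nz by blast
    then have "(p + q) mod 3 = 0" by (simp add: add.commute)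
    note r = residues_of_orthogonal_pair[OF k(4) this]
    show thesis
      by (rule normal_form[of e 0 k 0 p q]) (use e k r mn in auto)
  qed
  obtain g where g: "g \<in> Basis" "u \<bullet> g \<in> \<int>" "v \<bullet> g \<in> \<int>"
    using integer_coordinate_uniform[OF dim K] by blast
  show thesis
  proof (cases "\<forall>i j. (i - j) mod 3 \<noteq> 0 \<longrightarrow> L g i j \<noteq> 0")
    case True then show ?thesis using noshear g by blast
  next
    case False
    then obtain i0 j0 where ij0: "(i0 - j0) mod 3 \<noteq> 0" "L g i0 j0 = 0" by blast
    \<comment> \<open>The g-coordinate vanishes on an admissible combination, so a second axis has
      to supply the nonzero integer; this forces dimension 2.\<close>
    from K'[OF this(1)] obtain e where e: "e \<in> Basis" "L e i0 j0 \<noteq> 0" by blast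
    have ge: "g \<noteq> e" using e ij0 by auto
    have "DIM('a) \<noteq> 1" using ge e(1) g(1) by (metis card_1_singletonE singletonD)
    then have "DIM('a) = 2" using dim by simp
    then obtain x y :: 'a where xy: "Basis = {x, y}" by (auto simp: card_2_iff)
    have B: "Basis = {e, g}" using ge e(1) g(1) unfolding xy by blast
    have other: "L e i j \<in> \<int> \<and> L e i j \<noteq> 0" if "(i - j) mod 3 \<noteq> 0" "L g i j = 0" for i j
      using K'[OF that(1)] that(2) unfolding B by auto
    obtain m n :: int where mn: "u \<bullet> g = of_int m" "v \<bullet> g = of_int n"
      using g by (auto elim!: Ints_cases)
    show ?thesis
    proof (cases "m = 0 \<and> n = 0")
      case True
      then have z: "L g i j = 0" for i j by (simp add: L_def mn)
      then have "u \<bullet> e \<in> \<int>" "v \<bullet> e \<in> \<int>" "\<And>i j. (i - j) mod 3 \<noteq> 0 \<Longrightarrow> L e i j \<noteq> 0"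
        using other[OF _ z, of 1 0] other[OF _ z, of 0 1] other by (simp_all add: L_def[of e])
      then show ?thesis using noshear e(1) by blast
    next
      case False
      then obtain k p q where k: "k > 0" "m = k * p" "n = k * q" "coprime p q"
        using coprime_decomposition by blast
      have "real_of_int k * of_int (i0 * p + j0 * q) = 0"
        using ij0(2) by (simp add: L_def mn k algebra_simps)
      then have "of_int (i0 * p + j0 * q) = (0::real)" using k(1) by simp
      then have lin: "i0 * p + j0 * q = 0" by (simp only: of_int_eq_0_iff)
      have pq: "(p + q) mod 3 \<noteq> 0"
      proof
        assume 0: "(p + q) mod 3 = 0"
        obtain x y where xy: "x * p + y * q = 1"
          using bezout_int[of p q] k(4) by (auto simp: coprime_iff_gcd_eq_1)
        \<comment> \<open>The pairs with vanishing g-coordinate are the multiples of (-q, p), and t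
          is the multiple giving (i0, j0). If 3 divided p + q, no such pair would be
          admissible.\<close>
        define t where "t = x * j0 - y * i0"
        have "i0 = i0 * (x * p + y * q) - x * (i0 * p + j0 * q)" using lin xy by simp
        also have "\<dots> = - (t * q)" by (simp add: t_def algebra_simps)
        finally have i0: "i0 = - (t * q)" .
        have "j0 = j0 * (x * p + y * q) - y * (i0 * p + j0 * q)" using lin xy by simp
        also have "\<dots> = t * p" by (simp add: t_def algebra_simps)
        finally have "i0 - j0 = - t * (p + q)" using i0 by (simp add: algebra_simps)
        then show False using ij0(1) 0 by auto
      qed
      obtain \<alpha> \<beta> where ab: "\<alpha> * p + \<beta> * q = 1" "\<alpha> mod 3 = \<beta> mod 3"
        using bezout_congruent_mod3[OF k(4) pq] .
      have Lg: "L g q (- p) = 0" by (simp add: L_def mn k algebra_simps)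
      have "(q - - p) mod 3 \<noteq> 0" using pq by (simp add: add.commute)
      \<comment> \<open>On the admissible kernel element qu - pv the e-coordinate must be the
        nonzero integer; it is called \<tau>.\<close>
      from other[OF this Lg] obtain \<tau> :: int where \<tau>: "L e q (- p) = of_int \<tau>" "\<tau> \<noteq> 0"
        by (auto elim!: Ints_cases)
      have \<tau>': "of_int q * (u \<bullet> e) - of_int p * (v \<bullet> e) = of_int \<tau>" using \<tau>(1) by (simp add: L_def)
      \<comment> \<open>The vector \<alpha>u + \<beta>v has g-coordinate k and e-coordinate r, so
        the slope r/k shears its e-coordinate to 0. As u = p(\<alpha>u + \<beta>v) + \<beta>(qu -
        pv) and v = q(\<alpha>u + \<beta>v) - \<alpha>(qu - pv), only \<tau>\<beta> and
        -\<tau>\<alpha> remain. The sign of \<tau> is moved into the residues to make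
        \<open>N\<close> positive.\<close>
      define r where "r = of_int \<alpha> * (u \<bullet> e) + of_int \<beta> * (v \<bullet> e)"
      have ab': "real_of_int \<alpha> * of_int p + of_int \<beta> * of_int q = 1"
        using ab(1) by (metis of_int_1 of_int_add of_int_mult)
      have ru: "u \<bullet> e - r / k * (u \<bullet> g) = of_int (\<bar>\<tau>\<bar> * (sgn \<tau> * \<beta>))"
      proof -
        have "u \<bullet> e - r / k * (u \<bullet> g) = (u \<bullet> e) * (of_int \<alpha> * of_int p + of_int \<beta> * of_int q) - r * of_int p"
          using k(1) by (auto simp: mn k(2,3) ab')
        also have "\<dots> = of_int \<beta> * (of_int q * (u \<bullet> e) - of_int p * (v \<bullet> e))"
          by (simp add: r_def algebra_simps)
        also have "\<dots> = of_int (\<tau> * \<beta>)" by (simp add: \<tau>')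
        also have "\<tau> * \<beta> = \<bar>\<tau>\<bar> * (sgn \<tau> * \<beta>)" by (simp add: abs_mult_sgn mult.assoc[symmetric])
        finally show ?thesis .
      qed
      have rv: "v \<bullet> e - r / k * (v \<bullet> g) = of_int (\<bar>\<tau>\<bar> * (- sgn \<tau> * \<alpha>))"
      proof -
        have "v \<bullet> e - r / k * (v \<bullet> g) = (v \<bullet> e) * (of_int \<alpha> * of_int p + of_int \<beta> * of_int q) - r * of_int q"
          using k(1) by (auto simp: mn k(2,3) ab')
        also have "\<dots> = - of_int \<alpha> * (of_int q * (u \<bullet> e) - of_int p * (v \<bullet> e))"
          by (simp add: r_def algebra_simps)
        also have "\<dots> = of_int (\<tau> * - \<alpha>)" by (simp add: \<tau>')
        also have "\<tau> * - \<alpha> = \<bar>\<tau>\<bar> * (- sgn \<tau> * \<alpha>)" by (simp add: abs_mult_sgn mult.assoc[symmetric])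
        finally show ?thesis .
      qed
      have "\<alpha> mod 3 \<noteq> 0"
      proof
        assume "\<alpha> mod 3 = 0"
        then have "3 dvd \<alpha>" "3 dvd \<beta>" using ab(2) by auto
        then have "3 dvd \<alpha> * p + \<beta> * q" by simp
        then show False using ab(1) by simp
      qed
      have "sgn \<tau> = 1 \<or> sgn \<tau> = - 1" using \<tau>(2) by (simp add: sgn_if)
      note res = mod3_opposite_signs[OF \<open>\<alpha> mod 3 \<noteq> 0\<close> ab(2) this]
      have "\<bar>\<tau>\<bar> > 0" using \<tau>(2) by simp
      show ?thesis
        by (rule normal_form[OF e(1) disjI2[OF g(1)] ge \<open>\<bar>\<tau>\<bar> > 0\<close> g(2,3) ru rv res])
    qed
  qed
qed

section \<open>Tiling by three cubes in normal form\<close>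

definition int_lattice :: "'a::euclidean_space set" where
  "int_lattice = {z. \<forall>i\<in>Basis. z \<bullet> i \<in> \<int>}"

lemma int_lattice_closed:
  "0 \<in> int_lattice" "x \<in> int_lattice \<Longrightarrow> y \<in> int_lattice \<Longrightarrow> x + y \<in> int_lattice"
  "x \<in> int_lattice \<Longrightarrow> - x \<in> int_lattice"
  "x \<in> int_lattice \<Longrightarrow> y \<in> int_lattice \<Longrightarrow> x - y \<in> int_lattice"
  "i \<in> Basis \<Longrightarrow> i \<in> int_lattice"
  by (simp_all add: int_lattice_def inner_add_left inner_diff_left inner_Basis)

lemma inner_int_lattice: "x \<in> int_lattice \<Longrightarrow> y \<in> int_lattice \<Longrightarrow> x \<bullet> y \<in> \<int>"
  by (subst euclidean_inner) (auto simp: int_lattice_def intro!: Ints_sum)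

lemma countable_int_lattice: "countable (int_lattice :: 'a::euclidean_space set)"
proof -
  let ?f = "\<lambda>z::'a. restrict ((\<bullet>) z) Basis"
  have "inj_on ?f int_lattice"
  proof (rule inj_onI)
    fix x y :: 'a assume eq: "?f x = ?f y"
    show "x = y"
    proof (rule euclidean_eqI)
      fix b :: 'a assume "b \<in> Basis"
      then show "x \<bullet> b = y \<bullet> b" using fun_cong[OF eq, of b] by simp
    qed
  qed
  moreover have "?f ` int_lattice \<subseteq> (\<Pi>\<^sub>E i\<in>Basis. \<int>)"
    by (auto simp: int_lattice_def)
  moreover have "countable (\<Pi>\<^sub>E i\<in>(Basis :: 'a set). (\<int> :: real set))"
    by (intro countable_PiE) (auto simp: Ints_def)
  ultimately show ?thesis
    by (meson countable_image_inj_on countable_subset)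
qed

lemma mem_unit_cube_iff_box: "x \<in> unit_cube a \<longleftrightarrow> x - a \<in> box 0 One"
  unfolding unit_cube_def by (force simp: image_iff)

lemma mem_unit_cube: "x \<in> unit_cube a \<longleftrightarrow> (\<forall>i\<in>Basis. a \<bullet> i < x \<bullet> i \<and> x \<bullet> i < a \<bullet> i + 1)"
  by (simp add: mem_unit_cube_iff_box mem_box inner_diff_left less_diff_eq diff_less_eq add.commute)

lemma unit_cube_eq_box: "unit_cube a = box a (a + One)"
  by (rule set_eqI) (simp add: mem_unit_cube mem_box inner_add_left)

text \<open>The shear \<open>x \<mapsto> x - \<rho> (x \<bullet> g) e\<close> maps each cube
  onto a fundamental domain of the integer lattice.\<close>

locale three_cubes =
  fixes e g :: "'a::euclidean_space" and \<rho> :: real and N :: int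
    and w :: "nat \<Rightarrow> 'a" and \<kappa> :: "nat \<Rightarrow> int" and \<Omega> :: "'a set"
  assumes e: "e \<in> Basis" and g: "g = 0 \<or> g \<in> Basis" and g_ne_e: "g \<noteq> e" and N: "N > 0"
    and wg: "\<And>i. i < 3 \<Longrightarrow> (w i - w 0) \<bullet> g \<in> \<int>"
    and we: "\<And>i. i < 3 \<Longrightarrow> (w i - w 0) \<bullet> e - \<rho> * ((w i - w 0) \<bullet> g) = of_int (N * \<kappa> i)"
    and \<kappa>: "\<And>i j. i < 3 \<Longrightarrow> j < 3 \<Longrightarrow> i \<noteq> j \<Longrightarrow> \<kappa> i mod 3 \<noteq> \<kappa> j mod 3"
    and \<Omega>: "\<Omega> = (\<Union>i<3. unit_cube (w i))"
begin

definition shear :: "'a \<Rightarrow> 'a" where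
  "shear x = x - (\<rho> * (x \<bullet> g)) *\<^sub>R e"

lemma eg [simp]: "e \<bullet> g = 0" "g \<bullet> e = 0" "e \<bullet> e = 1"
  using e g g_ne_e by (auto simp: inner_Basis)

lemma shear_linear: "shear (x + y) = shear x + shear y" "shear (x - y) = shear x - shear y"
  by (simp_all add: shear_def algebra_simps inner_add_left inner_diff_left)

lemma shear_inner_e: "shear x \<bullet> e = x \<bullet> e - \<rho> * (x \<bullet> g)"
  by (simp add: shear_def inner_diff_left)

lemma shear_inner: "i \<in> Basis \<Longrightarrow> i \<noteq> e \<Longrightarrow> shear x \<bullet> i = x \<bullet> i"
  using e by (simp add: shear_def inner_diff_left inner_Basis)

lemma shear_inner_g: "shear x \<bullet> g = x \<bullet> g"
  by (simp add: shear_def inner_diff_left)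

text \<open>Let \<open>r\<close> be the difference of the positions inside the two cubes, with all
  coordinates below 1 in absolute value. Its g-coordinate is an integer, hence 0, so the shear does
  not move its e-coordinate, which is then also an integer and 0. Only the contribution of the cube
  positions is left.\<close>

lemma shear_lattice_difference:
  assumes i: "i < 3" and j: "j < 3" and x: "x \<in> unit_cube (w i)" and y: "y \<in> unit_cube (w j)"
    and xy: "shear (x - y) \<in> int_lattice"
  shows "shear (x - y) \<bullet> e = of_int (N * (\<kappa> i - \<kappa> j))" and "i = j \<Longrightarrow> x = y"
proof -
  define r where "r = (x - w i) - (y - w j)"
  have r: "\<bar>r \<bullet> b\<bar> < 1" if "b \<in> Basis" for b
    using x y that by (auto simp: r_def mem_unit_cube inner_diff_left) (smt (verit))+
  have int0: "t = 0" if "t \<in> \<int>" "\<bar>t\<bar> < 1" for t :: real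
    using that by (auto elim!: Ints_cases)
  have wij: "(w i - w j) \<bullet> g \<in> \<int>"
    using Ints_diff[OF wg[OF i] wg[OF j]] by (simp add: inner_diff_left)
  have wije: "(w i - w j) \<bullet> e - \<rho> * ((w i - w j) \<bullet> g) = of_int (N * (\<kappa> i - \<kappa> j))"
    using we[OF i] we[OF j] by (simp add: inner_diff_left algebra_simps)
  have "(x - y) \<bullet> g \<in> \<int>"
    using xy g g_ne_e shear_inner[of g "x - y"] by (auto simp: int_lattice_def)
  then have "r \<bullet> g \<in> \<int>"
    using Ints_diff[OF _ wij, of "(x - y) \<bullet> g"] by (simp add: r_def inner_diff_left algebra_simps)
  then have rg: "r \<bullet> g = 0" using int0 r g by auto
  have sp: "shear (x - y) \<bullet> e = r \<bullet> e - \<rho> * (r \<bullet> g) + ((w i - w j) \<bullet> e - \<rho> * ((w i - w j) \<bullet> g))"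
    by (simp add: shear_inner_e r_def inner_diff_left algebra_simps)
  then have *: "shear (x - y) \<bullet> e = r \<bullet> e + of_int (N * (\<kappa> i - \<kappa> j))"
    by (simp add: rg wije)
  have "shear (x - y) \<bullet> e \<in> \<int>" using xy e by (simp add: int_lattice_def)
  then have "r \<bullet> e \<in> \<int>" using Ints_diff[OF _ Ints_of_int] * by (metis add_diff_cancel_right')
  then have re: "r \<bullet> e = 0" using int0 r e by blast
  with * show "shear (x - y) \<bullet> e = of_int (N * (\<kappa> i - \<kappa> j))" by simp
  assume "i = j"
  then have "r = x - y" by (simp add: r_def)
  show "x = y"
  proof (rule euclidean_eqI)
    fix b :: 'a assume b: "b \<in> Basis"
    show "x \<bullet> b = y \<bullet> b"
    proof (cases "b = e")
      case True then show ?thesis using re \<open>r = x - y\<close> by (simp add: inner_diff_left)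
    next
      case False
      then have "r \<bullet> b \<in> \<int>" using xy b shear_inner[OF b False, of "x - y"] \<open>r = x - y\<close> by (auto simp: int_lattice_def)
      then have "r \<bullet> b = 0" using int0 r[OF b] by blast
      then show ?thesis using \<open>r = x - y\<close> by (simp add: inner_diff_left)
    qed
  qed
qed

text \<open>Rounding down works on every axis but \<open>e\<close>. There the shear subtracts \<rho>
  times the g-coordinate m of the translation, so t \<bullet> e must have the form \<rho>m + n and
  the rounding is done relative to \<rho>m. Genericity keeps the result off the faces.\<close>

lemma ex_translate_into_cube:
  assumes gen: "\<And>b m n. b \<in> Basis \<Longrightarrow> (x - p) \<bullet> b \<noteq> \<rho> * of_int m + of_int n"
  shows "\<exists>t. shear t \<in> int_lattice \<and> x - t \<in> unit_cube p"
proof -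
  define y where "y = x - p"
  have yfl: "of_int \<lfloor>y \<bullet> b\<rfloor> < y \<bullet> b" if "b \<in> Basis" for b
  proof -
    have "y \<bullet> b \<noteq> of_int \<lfloor>y \<bullet> b\<rfloor>" using gen[OF that, of 0 "\<lfloor>y \<bullet> b\<rfloor>"] unfolding y_def by simp
    then show ?thesis using of_int_floor_le[of "y \<bullet> b"] by linarith
  qed
  define m where "m = (if g = 0 then 0 else \<lfloor>y \<bullet> g\<rfloor>)"
  define n where "n = \<lfloor>y \<bullet> e - \<rho> * of_int m\<rfloor>"
  define t where "t = (\<Sum>b\<in>Basis. (if b = e then \<rho> * of_int m + of_int n else of_int \<lfloor>y \<bullet> b\<rfloor>) *\<^sub>R b)"
  have t: "t \<bullet> b = (if b = e then \<rho> * of_int m + of_int n else of_int \<lfloor>y \<bullet> b\<rfloor>)" if "b \<in> Basis" for b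
    using that by (simp add: t_def)
  have tg: "t \<bullet> g = of_int m" using t[of g] g g_ne_e by (auto simp: m_def)
  have "shear t \<bullet> b \<in> \<int>" if b: "b \<in> Basis" for b
  proof (cases "b = e")
    case True then show ?thesis using t[OF e] tg by (simp add: shear_inner_e)
  next
    case False then show ?thesis using t[OF b] shear_inner[OF b False] by simp
  qed
  moreover have "p \<bullet> b < (x - t) \<bullet> b \<and> (x - t) \<bullet> b < p \<bullet> b + 1" if b: "b \<in> Basis" for b
  proof (cases "b = e")
    case True
    have "of_int n \<le> y \<bullet> e - \<rho> * of_int m" "y \<bullet> e - \<rho> * of_int m < of_int n + 1"
      unfolding n_def by linarith+
    moreover have "y \<bullet> e - \<rho> * of_int m \<noteq> of_int n" using gen[OF e, of m n] by (simp add: y_def)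
    ultimately show ?thesis using t[OF e] True by (simp add: y_def inner_diff_left)
  next
    case False
    then have "t \<bullet> b = of_int \<lfloor>y \<bullet> b\<rfloor>" using t[OF b] by simp
    moreover have "y \<bullet> b < of_int \<lfloor>y \<bullet> b\<rfloor> + 1" by linarith
    moreover have "(x - t) \<bullet> b = y \<bullet> b + p \<bullet> b - t \<bullet> b" by (simp add: y_def inner_diff_left)
    ultimately show ?thesis using yfl[OF b] by linarith
  qed
  ultimately show ?thesis unfolding int_lattice_def mem_unit_cube by blast
qed

lemma AE_generic:
  "AE x in lebesgue. \<forall>i<3::nat. \<forall>b\<in>Basis. \<forall>m n :: int. (x - w i) \<bullet> b \<noteq> \<rho> * of_int m + of_int n"
proof -
  have "AE x in lebesgue. (x - w i) \<bullet> b \<noteq> \<rho> * of_int m + of_int n" if "b \<in> Basis" for i b and m n :: int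
  proof -
    have "negligible {x. x \<bullet> b = w i \<bullet> b + (\<rho> * of_int m + of_int n)}"
      by (rule negligible_standard_hyperplane[OF that])
    then show ?thesis
      unfolding negligible_iff_null_sets
      by (rule AE_I') (auto simp: inner_diff_left algebra_simps)
  qed
  then show ?thesis
    by (simp add: AE_all_countable AE_ball_countable AE_finite_all)
qed

definition tiling_set :: "'a set" where
  "tiling_set = {t. shear t \<in> int_lattice \<and> (\<lfloor>shear t \<bullet> e\<rfloor> div N) mod 3 = 0}"

lemma inj_shear: "inj shear"
proof (rule injI)
  fix x y assume "shear x = shear y"
  then have "x \<bullet> g = y \<bullet> g" using shear_inner_g by metis
  then show "x = y" using \<open>shear x = shear y\<close> by (simp add: shear_def)
qed

lemma countable_tiling_set: "countable tiling_set"
proof -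
  have "countable (shear -` int_lattice)"
    using countable_image_inj_on[of shear "shear -` int_lattice"] inj_on_subset[OF inj_shear, of "shear -` int_lattice"]
      countable_subset[OF image_vimage_subset[of shear int_lattice] countable_int_lattice] by blast
  then show ?thesis by (rule countable_subset[rotated]) (auto simp: tiling_set_def)
qed

text \<open>The three residues of \<open>\<kappa>\<close> are distinct and therefore exhaust the
  classes modulo 3.\<close>

lemma residues_hit_once: "\<exists>i<3::nat. \<forall>j<3. (K - \<kappa> j) mod 3 = 0 \<longleftrightarrow> j = i"
proof -
  have inj: "inj_on (\<lambda>i. \<kappa> i mod 3) {..<3}" using \<kappa> by (auto simp: inj_on_def)
  have "(\<lambda>i. \<kappa> i mod 3) ` {..<3} \<subseteq> {0..<3}" by auto
  moreover have "card ((\<lambda>i. \<kappa> i mod 3) ` {..<3}) = card {0..<3::int}" using card_image[OF inj] by simp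
  ultimately have "(\<lambda>i. \<kappa> i mod 3) ` {..<3} = {0..<3}" by (intro card_subset_eq) auto
  moreover have "K mod 3 \<in> {0..<3}" by simp
  ultimately obtain i where i: "i < 3" "\<kappa> i mod 3 = K mod 3" by (metis (mono_tags, lifting) imageE lessThan_iff)
  have "(K - \<kappa> j) mod 3 = 0 \<longleftrightarrow> j = i" if "j < 3" for j
  proof -
    have "(K - \<kappa> j) mod 3 = 0 \<longleftrightarrow> K mod 3 = \<kappa> j mod 3"
      by (simp add: mod_eq_dvd_iff dvd_eq_mod_eq_0)
    then show ?thesis using i \<kappa>[OF that i(1)] by metis
  qed
  with i(1) show ?thesis by blast
qed

text \<open>Each cube admits exactly one translation \<open>t i\<close> from the sheared lattice.
  The integer e-coordinates of these differ by exact multiples of \<open>N\<close>, so the indices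
  of their blocks of length \<open>N\<close> are K - \<kappa> i, of which exactly one is divisible
  by 3.\<close>

lemma unique_translate:
  assumes gen: "\<forall>i<3::nat. \<forall>b\<in>Basis. \<forall>m n :: int. (x - w i) \<bullet> b \<noteq> \<rho> * of_int m + of_int n"
  shows "\<exists>!t. t \<in> tiling_set \<and> x - t \<in> \<Omega>"
proof -
  have "\<forall>i. \<exists>t. i < 3 \<longrightarrow> shear t \<in> int_lattice \<and> x - t \<in> unit_cube (w i)"
    using ex_translate_into_cube[of x] gen by blast
  from choice[OF this] obtain t where
    t: "shear (t i) \<in> int_lattice" "x - t i \<in> unit_cube (w i)" if "i < 3" for i by blast
  define n where "n i = \<lfloor>shear (t i) \<bullet> e\<rfloor>" for i
  have n: "of_int (n i) = shear (t i) \<bullet> e" if "i < 3" for i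
    using t(1)[OF that] e by (simp add: n_def int_lattice_def)
  have ni: "n i = n 0 - N * \<kappa> i + N * \<kappa> 0" if i: "i < 3" for i
  proof -
    have eq: "(x - t i) - (x - t 0) = t 0 - t i" by simp
    have "shear (t 0 - t i) \<in> int_lattice" using t i by (simp add: shear_linear int_lattice_closed)
    then have "shear (t 0 - t i) \<bullet> e = of_int (N * (\<kappa> i - \<kappa> 0))"
      using shear_lattice_difference(1)[OF i _ t(2)[OF i] t(2)] unfolding eq by simp
    then have "real_of_int (n 0 - n i) = of_int (N * (\<kappa> i - \<kappa> 0))"
      using n[OF i] n[of 0] by (simp add: shear_linear inner_diff_left)
    then have "n 0 - n i = N * (\<kappa> i - \<kappa> 0)" by (simp only: of_int_eq_iff)
    then show ?thesis by (simp add: algebra_simps)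
  qed
  define K where "K = n 0 div N + \<kappa> 0"
  have div: "n i div N = K - \<kappa> i" if "i < 3" for i
  proof -
    have "n i = n 0 + N * (\<kappa> 0 - \<kappa> i)" using ni[OF that] by (simp add: algebra_simps)
    then show ?thesis using N by (simp add: K_def)
  qed
  obtain i where i: "i < 3" "\<And>j. j < 3 \<Longrightarrow> (K - \<kappa> j) mod 3 = 0 \<longleftrightarrow> j = i"
    using residues_hit_once by blast
  show ?thesis
  proof (rule ex1I[of _ "t i"])
    show "t i \<in> tiling_set \<and> x - t i \<in> \<Omega>"
      using t[OF i(1)] i div[OF i(1)] by (auto simp: tiling_set_def \<Omega> n_def)
  next
    fix s assume s: "s \<in> tiling_set \<and> x - s \<in> \<Omega>"
    then obtain j where j: "j < 3" "x - s \<in> unit_cube (w j)" by (auto simp: \<Omega>)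
    have eq: "(x - s) - (x - t j) = t j - s" by simp
    have "shear (t j - s) \<in> int_lattice"
      using s t[OF j(1)] by (simp add: shear_linear int_lattice_closed tiling_set_def)
    then have "x - s = x - t j"
      using shear_lattice_difference(2)[OF j(1) j(1) j(2) t(2)[OF j(1)]] unfolding eq by simp
    then have "s = t j" by simp
    moreover have "j = i" using i(2)[OF j(1)] div[OF j(1)] s \<open>s = t j\<close> by (simp add: tiling_set_def n_def)
    ultimately show "s = t i" by simp
  qed
qed

lemma tiles: "admissible_domain \<Omega> \<Longrightarrow> is_tile \<Omega>"
  unfolding is_tile_def
proof (intro conjI exI[of _ tiling_set] countable_tiling_set)
  show "AE x in lebesgue. ((\<lambda>t. indicator \<Omega> (x - t) :: real) has_sum 1) tiling_set"
    using AE_generic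
  proof eventually_elim
    case (elim x)
    from unique_translate[OF elim] obtain t where
      t: "t \<in> tiling_set" "x - t \<in> \<Omega>" "\<And>s. s \<in> tiling_set \<Longrightarrow> x - s \<in> \<Omega> \<Longrightarrow> s = t" by blast
    have "((\<lambda>t. indicator \<Omega> (x - t) :: real) has_sum 1) {t}"
      by (rule has_sum_finiteI) (simp_all add: t(2))
    also have "?this \<longleftrightarrow> ?case"
    proof (rule has_sum_cong_neutral)
      fix s assume "s \<in> tiling_set - {t}"
      then show "(indicator \<Omega> (x - s) :: real) = 0" using t(3) by (auto simp: indicator_def)
    qed (use t(1) in auto)
    finally show ?case .
  qed
qed

end

section \<open>Trigonometric approximation\<close>

definition expo_span :: "'a::euclidean_space set \<Rightarrow> ('a \<Rightarrow> complex) \<Rightarrow> bool" where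
  "expo_span \<Lambda> q \<longleftrightarrow> (\<exists>F c. finite F \<and> F \<subseteq> \<Lambda> \<and> q = (\<lambda>x. \<Sum>l\<in>F. c l * expo l x))"

lemma expo_add: "expo (k + l) x = expo k x * expo l x"
  by (simp add: expo_def inner_add_left distrib_left exp_add)

lemma expo_add_right: "expo l (x + y) = expo l x * expo l y"
  by (simp add: expo_def inner_add_right distrib_left exp_add)

lemma expo_0 [simp]: "expo 0 x = 1"
  by (simp add: expo_def)

lemma expo_minus: "expo (- l) x = cnj (expo l x)"
  by (simp add: expo_def exp_cnj)

lemma expo_commute: "expo l x = expo x l"
  by (simp add: expo_def inner_commute)

lemma norm_expo [simp]: "norm (expo l x) = 1"
  by (simp add: expo_def norm_exp_eq_Re)

lemma expo_eq_cis: "expo l x = cis (2 * pi * (l \<bullet> x))"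
  by (simp add: expo_def cis_conv_exp mult_ac)

lemma expo_nonzero [simp]: "expo l x \<noteq> 0"
  by (simp add: expo_def)

lemma expo_eq_1_iff: "expo l x = 1 \<longleftrightarrow> l \<bullet> x \<in> \<int>"
proof -
  have "expo l x = 1 \<longleftrightarrow> (\<exists>n::int. 2 * pi * (l \<bullet> x) = of_int (2 * n) * pi)"
    by (simp add: expo_def exp_eq_1)
  also have "\<dots> \<longleftrightarrow> (\<exists>n::int. l \<bullet> x = of_int n)"
    by simp
  also have "\<dots> \<longleftrightarrow> l \<bullet> x \<in> \<int>" by (auto simp: Ints_def)
  finally show ?thesis .
qed

lemma continuous_on_expo [continuous_intros]: "continuous_on S (expo l)"
  unfolding expo_def by (intro continuous_intros)

lemma expo_span_single: "l \<in> \<Lambda> \<Longrightarrow> expo_span \<Lambda> (\<lambda>x. c * expo l x)"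
  unfolding expo_span_def by (intro exI[of _ "{l}"] exI[of _ "\<lambda>_. c"]) simp

lemma expo_span_0: "expo_span \<Lambda> (\<lambda>x. 0)"
  unfolding expo_span_def by (intro exI[of _ "{}"] exI[of _ "\<lambda>_. 0"]) simp

lemma expo_span_add:
  assumes "expo_span \<Lambda> p" "expo_span \<Lambda> q"
  shows "expo_span \<Lambda> (\<lambda>x. p x + q x)"
proof -
  obtain F c G d where F: "finite F" "F \<subseteq> \<Lambda>" "p = (\<lambda>x. \<Sum>l\<in>F. c l * expo l x)"
    and G: "finite G" "G \<subseteq> \<Lambda>" "q = (\<lambda>x. \<Sum>l\<in>G. d l * expo l x)"
    using assms unfolding expo_span_def by blast
  define h where "h l = (if l \<in> F then c l else 0) + (if l \<in> G then d l else 0)" for l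
  have "p x + q x = (\<Sum>l\<in>F \<union> G. h l * expo l x)" for x
  proof -
    have "(\<Sum>l\<in>F \<union> G. h l * expo l x)
      = (\<Sum>l\<in>F \<union> G. if l \<in> F then c l * expo l x else 0) + (\<Sum>l\<in>F \<union> G. if l \<in> G then d l * expo l x else 0)"
      unfolding sum.distrib[symmetric] by (intro sum.cong) (auto simp: h_def algebra_simps)
    also have "\<dots> = p x + q x"
      using F G by (simp add: sum.inter_restrict[symmetric] Int_absorb1)
    finally show ?thesis by simp
  qed
  then show ?thesis
    unfolding expo_span_def using F G by (intro exI[of _ "F \<union> G"] exI[of _ h]) auto
qed

lemma expo_span_sum:
  "finite I \<Longrightarrow> (\<And>i. i \<in> I \<Longrightarrow> expo_span \<Lambda> (p i)) \<Longrightarrow> expo_span \<Lambda> (\<lambda>x. \<Sum>i\<in>I. p i x)"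
  by (induction I rule: finite_induct) (auto intro: expo_span_0 expo_span_add)

lemma expo_span_mult:
  assumes "expo_span \<Lambda> p" "expo_span \<Lambda>' q" and add: "\<And>k l. k \<in> \<Lambda> \<Longrightarrow> l \<in> \<Lambda>' \<Longrightarrow> k + l \<in> \<Lambda>''"
  shows "expo_span \<Lambda>'' (\<lambda>x. p x * q x)"
proof -
  obtain F c G d where F: "finite F" "F \<subseteq> \<Lambda>" "p = (\<lambda>x. \<Sum>l\<in>F. c l * expo l x)"
    and G: "finite G" "G \<subseteq> \<Lambda>'" "q = (\<lambda>x. \<Sum>l\<in>G. d l * expo l x)"
    using assms unfolding expo_span_def by blast
  have "(\<lambda>x. p x * q x) = (\<lambda>x. \<Sum>k\<in>F. \<Sum>l\<in>G. c k * d l * expo (k + l) x)"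
    by (simp add: F G sum_product expo_add mult_ac)
  moreover have "expo_span \<Lambda>'' (\<lambda>x. \<Sum>k\<in>F. \<Sum>l\<in>G. c k * d l * expo (k + l) x)"
    using F G add by (intro expo_span_sum expo_span_single) auto
  ultimately show ?thesis by simp
qed

lemma expo_span_cmult:
  assumes "expo_span \<Lambda> p" shows "expo_span \<Lambda> (\<lambda>x. a * p x)"
  using expo_span_mult[of "{0}" "\<lambda>x. a * expo 0 x" \<Lambda> p \<Lambda>] expo_span_single[of 0 "{0}" a] assms by simp

lemma expo_span_periodic:
  assumes "expo_span int_lattice q" "z \<in> int_lattice"
  shows "q (x + z) = q x"
proof -
  have "expo l (x + z) = expo l x" if "l \<in> int_lattice" for l
    using expo_eq_1_iff[of l z] inner_int_lattice[OF that assms(2)] by (simp add: expo_add_right)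
  then show ?thesis using assms(1) unfolding expo_span_def by (auto intro!: sum.cong)
qed

text \<open>The embedding of the torus as a product of circles, one for each axis; cosines and sines
  are collected in two separate vectors.\<close>

definition circle_coords :: "'a::euclidean_space \<Rightarrow> 'a \<times> 'a" where
  "circle_coords x = (\<Sum>i\<in>Basis. cos (2 * pi * (x \<bullet> i)) *\<^sub>R i, \<Sum>i\<in>Basis. sin (2 * pi * (x \<bullet> i)) *\<^sub>R i)"

lemma circle_coords_eq_imp:
  assumes "circle_coords x = circle_coords y"
  shows "x - y \<in> int_lattice"
  unfolding int_lattice_def
proof safe
  fix i :: 'a assume i: "i \<in> Basis"
  have "fst (circle_coords x) \<bullet> i = fst (circle_coords y) \<bullet> i" "snd (circle_coords x) \<bullet> i = snd (circle_coords y) \<bullet> i"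
    using assms by simp_all
  then have "cos (2 * pi * (x \<bullet> i)) = cos (2 * pi * (y \<bullet> i))" "sin (2 * pi * (x \<bullet> i)) = sin (2 * pi * (y \<bullet> i))"
    using i by (simp_all add: circle_coords_def)
  then obtain n :: int where "2 * pi * (x \<bullet> i) = 2 * pi * (y \<bullet> i) + 2 * pi * of_int n"
    using sin_cos_eq_iff[of "2 * pi * (x \<bullet> i)" "2 * pi * (y \<bullet> i)"] by auto
  then have "2 * pi * (x \<bullet> i) = 2 * pi * (y \<bullet> i + of_int n)" by (simp add: distrib_left)
  then have "x \<bullet> i = y \<bullet> i + of_int n" by simp
  then show "(x - y) \<bullet> i \<in> \<int>" by (simp add: inner_diff_left)
qed

text \<open>By Euler's formula a linear function of the cosines and sines is a combination of
  exponentials with frequencies plus or minus a basis vector. Products stay in the span because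
  frequencies add.\<close>

lemma polynomial_in_circle_coords:
  assumes "real_polynomial_function r"
  shows "expo_span int_lattice (\<lambda>x. of_real (r (circle_coords x)))"
  using assms
proof (induction r rule: real_polynomial_function.induct)
  case (linear f)
  interpret f: bounded_linear f by fact
  have split: "f (a, b) = f (a, 0) + f (0, b)" for a b
    using f.add[of "(a, 0)" "(0, b)"] by simp
  have l1: "f (\<Sum>i\<in>Basis. a i *\<^sub>R i, 0) = (\<Sum>i\<in>Basis. a i * f (i, 0))" for a :: "'a \<Rightarrow> real"
  proof -
    have "f (\<Sum>i\<in>Basis. a i *\<^sub>R i, 0) = f (\<Sum>i\<in>Basis. a i *\<^sub>R (i, 0))"
      by (rule arg_cong[of _ _ f]) (simp add: prod_eq_iff fst_sum snd_sum)
    then show ?thesis by (simp only: f.sum f.scaleR real_scaleR_def)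
  qed
  have l2: "f (0, \<Sum>i\<in>Basis. a i *\<^sub>R i) = (\<Sum>i\<in>Basis. a i * f (0, i))" for a :: "'a \<Rightarrow> real"
  proof -
    have "f (0, \<Sum>i\<in>Basis. a i *\<^sub>R i) = f (\<Sum>i\<in>Basis. a i *\<^sub>R (0, i))"
      by (rule arg_cong[of _ _ f]) (simp add: prod_eq_iff fst_sum snd_sum)
    then show ?thesis by (simp only: f.sum f.scaleR real_scaleR_def)
  qed
  have "complex_of_real (f (circle_coords x)) =
      (\<Sum>i\<in>Basis. (of_real (f (i, 0)) / 2 - \<i> * of_real (f (0, i)) / 2) * expo i x
         + (of_real (f (i, 0)) / 2 + \<i> * of_real (f (0, i)) / 2) * expo (- i) x)" for x
  proof -
    have "(of_real (f (i, 0)) / 2 - \<i> * of_real (f (0, i)) / 2) * expo i x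
         + (of_real (f (i, 0)) / 2 + \<i> * of_real (f (0, i)) / 2) * expo (- i) x
       = of_real (cos (2 * pi * (x \<bullet> i)) * f (i, 0) + sin (2 * pi * (x \<bullet> i)) * f (0, i))" for i
      unfolding expo_minus expo_eq_cis by (simp add: complex_eq_iff inner_commute)
    moreover have "f (circle_coords x)
        = (\<Sum>i\<in>Basis. cos (2 * pi * (x \<bullet> i)) * f (i, 0)) + (\<Sum>i\<in>Basis. sin (2 * pi * (x \<bullet> i)) * f (0, i))"
      unfolding circle_coords_def by (subst split) (simp only: l1 l2)
    ultimately show ?thesis by (simp add: sum.distrib[symmetric])
  qed
  then show ?case
    by (simp only:) (intro expo_span_sum expo_span_add expo_span_single finite_Basis, auto intro: int_lattice_closed)
next
  case (const c)
  show ?case using expo_span_single[of 0 int_lattice "of_real c"] by (simp add: int_lattice_closed)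
next
  case (add f g)
  then show ?case using expo_span_add[OF add.IH] by simp
next
  case (mult f g)
  then show ?case using expo_span_mult[OF mult.IH int_lattice_closed(2)] by simp
qed

lemma ex_lattice_translate_in_cube:
  fixes x :: "'a::euclidean_space"
  obtains z where "z \<in> int_lattice" "x + z \<in> cbox 0 One"
proof
  define z where "z = (\<Sum>i\<in>Basis. of_int (- \<lfloor>x \<bullet> i\<rfloor>) *\<^sub>R i)"
  have z: "z \<bullet> i = of_int (- \<lfloor>x \<bullet> i\<rfloor>)" if "i \<in> Basis" for i
    unfolding z_def by (rule inner_sum_left_Basis[OF that])
  then show "z \<in> int_lattice" by (simp add: int_lattice_def)
  have "0 \<le> (x + z) \<bullet> i \<and> (x + z) \<bullet> i \<le> 1" if "i \<in> Basis" for i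
    using z[OF that] by (simp add: inner_add_left) linarith
  then show "x + z \<in> cbox 0 One" by (simp add: mem_box)
qed

text \<open>The Stone--Weierstrass theorem on the torus, realised as the image of the unit cube under
  \<open>circle_coords\<close>.\<close>

lemma trigonometric_approximation:
  fixes H :: "'a::euclidean_space \<Rightarrow> complex"
  assumes cont: "continuous_on (cbox 0 One) H" and per: "\<And>x z. z \<in> int_lattice \<Longrightarrow> H (x + z) = H x"
    and "\<epsilon> > 0"
  obtains q where "expo_span int_lattice q" "\<And>x. norm (H x - q x) < \<epsilon>"
proof -
  let ?C = "cbox 0 One :: 'a set"
  define S where "S = circle_coords ` ?C"
  have cc: "continuous_on ?C circle_coords"
    unfolding circle_coords_def by (intro continuous_intros)
  have "compact S" unfolding S_def by (intro compact_continuous_image cc compact_cbox)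
  \<comment> \<open>This is \<open>H\<close> as a function on the torus; the choice of preimage is
    immaterial by periodicity.\<close>
  define h where "h s = H (SOME y. circle_coords y = s)" for s
  have h: "h (circle_coords x) = H x" for x
  proof -
    have "circle_coords (SOME y. circle_coords y = circle_coords x) = circle_coords x"
      by (rule someI) simp
    then have "(SOME y. circle_coords y = circle_coords x) - x \<in> int_lattice" by (rule circle_coords_eq_imp)
    from per[OF this, of x] show ?thesis by (simp add: h_def)
  qed
  \<comment> \<open>Continuity descends because a continuous map from the compact cube onto its
    image is a quotient map.\<close>
  have "continuous_on S h"
    unfolding continuous_openin_preimage_eq
  proof (intro allI impI)
    fix U :: "complex set" assume U: "open U"
    have "?C \<inter> circle_coords -` (S \<inter> h -` U) = ?C \<inter> H -` U"
      by (rule set_eqI) (auto simp only: S_def h Int_iff vimage_eq imageI)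
    moreover have "openin (top_of_set ?C) (?C \<inter> H -` U)"
      using cont U by (rule continuous_openin_preimage_gen)
    moreover have "openin (top_of_set ?C) (?C \<inter> circle_coords -` (S \<inter> h -` U)) \<longleftrightarrow> openin (top_of_set S) (S \<inter> h -` U)"
      by (rule Abstract_Topology_2.continuous_imp_quotient_map[OF cc _ compact_cbox]) (auto simp: S_def)
    ultimately show "openin (top_of_set S) (S \<inter> h -` U)" by simp
  qed
  from Stone_Weierstrass_polynomial_function[OF \<open>compact S\<close> this \<open>\<epsilon> > 0\<close>]
  obtain p where p: "polynomial_function p" "\<And>s. s \<in> S \<Longrightarrow> norm (h s - p s) < \<epsilon>" by blast
  define q where "q x = p (circle_coords x)" for x
  have "real_polynomial_function (Re \<circ> p)" "real_polynomial_function (Im \<circ> p)"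
    using p(1) unfolding polynomial_function_def using bounded_linear_Re bounded_linear_Im by blast+
  then have "expo_span int_lattice (\<lambda>x. of_real ((Re \<circ> p) (circle_coords x)) + \<i> * of_real ((Im \<circ> p) (circle_coords x)))"
    by (intro expo_span_add expo_span_cmult polynomial_in_circle_coords)
  also have "(\<lambda>x. of_real ((Re \<circ> p) (circle_coords x)) + \<i> * of_real ((Im \<circ> p) (circle_coords x))) = q"
    by (simp add: fun_eq_iff q_def complex_eq_iff)
  finally have q: "expo_span int_lattice q" .
  have "norm (H x - q x) < \<epsilon>" for x
  proof -
    obtain z where z: "z \<in> int_lattice" "x + z \<in> ?C" by (rule ex_lattice_translate_in_cube)
    have "H x - q x = H (x + z) - q (x + z)" using per[OF z(1)] expo_span_periodic[OF q z(1)] by simp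
    also have "\<dots> = h (circle_coords (x + z)) - p (circle_coords (x + z))" by (simp add: h q_def)
    finally show ?thesis using p(2)[of "circle_coords (x + z)"] z(2) by (simp add: S_def)
  qed
  with q that show thesis by blast
qed

lemma finite_int_lattice_bounded:
  fixes B :: "'a::euclidean_space set"
  assumes "bounded B"
  shows "finite (int_lattice \<inter> B)"
proof -
  obtain R where R: "\<And>x. x \<in> B \<Longrightarrow> norm x \<le> R" using assms by (auto simp: bounded_iff)
  let ?f = "\<lambda>z::'a. restrict (\<lambda>i. \<lfloor>z \<bullet> i\<rfloor>) Basis"
  have "inj_on ?f (int_lattice \<inter> B)"
  proof (rule inj_onI)
    fix x y :: 'a assume xy: "x \<in> int_lattice \<inter> B" "y \<in> int_lattice \<inter> B" and eq: "?f x = ?f y"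
    show "x = y"
    proof (rule euclidean_eqI)
      fix b :: 'a assume b: "b \<in> Basis"
      then have "\<lfloor>x \<bullet> b\<rfloor> = \<lfloor>y \<bullet> b\<rfloor>" using fun_cong[OF eq, of b] by simp
      then show "x \<bullet> b = y \<bullet> b" using xy b by (auto simp: int_lattice_def elim!: Ints_cases dest!: bspec[of _ _ b])
    qed
  qed
  moreover have "?f ` (int_lattice \<inter> B) \<subseteq> (\<Pi>\<^sub>E i\<in>Basis. {\<lfloor>- R\<rfloor>..\<lfloor>R\<rfloor>})"
  proof (intro image_subsetI PiE_I)
    fix x i :: 'a assume "x \<in> int_lattice \<inter> B" "i \<in> Basis"
    then have "\<bar>x \<bullet> i\<bar> \<le> R" using R[of x] Basis_le_norm[of i x] by simp
    then have "- R \<le> x \<bullet> i" "x \<bullet> i \<le> R" by auto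
    then show "?f x i \<in> {\<lfloor>- R\<rfloor>..\<lfloor>R\<rfloor>}" using \<open>i \<in> Basis\<close> by (simp add: floor_mono)
  qed simp
  moreover have "finite (\<Pi>\<^sub>E i\<in>(Basis :: 'a set). {\<lfloor>- R\<rfloor>..\<lfloor>R\<rfloor>})" by (intro finite_PiE) auto
  ultimately show ?thesis by (meson finite_imageD finite_subset)
qed

text \<open>The summation range varies with x, but for all x in the unit cube it lies in one finite
  set of lattice points, those that are differences of a point of \<open>B\<close> and a point of
  the cube.\<close>

lemma periodization:
  fixes k :: "'a::euclidean_space \<Rightarrow> complex"
  assumes cont: "continuous_on UNIV k" and bd: "bounded B" and supp: "\<And>x. x \<notin> B \<Longrightarrow> k x = 0"
  defines "H \<equiv> \<lambda>x. \<Sum>z | z \<in> int_lattice \<and> x + z \<in> B. k (x + z)"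
  shows "continuous_on (cbox 0 One) H" "\<And>x z. z \<in> int_lattice \<Longrightarrow> H (x + z) = H x"
proof -
  define D where "D = int_lattice \<inter> (\<Union>x\<in>B. \<Union>y\<in>(cbox 0 One :: 'a set). {x - y})"
  have "finite D" unfolding D_def
    by (rule finite_int_lattice_bounded, rule bounded_differences[OF bd bounded_cbox])
  have "H x = (\<Sum>z\<in>D. k (x + z))" if "x \<in> cbox 0 One" for x
    unfolding H_def
  proof (rule sum.mono_neutral_left[OF \<open>finite D\<close>])
    show "{z \<in> int_lattice. x + z \<in> B} \<subseteq> D" using that by (force simp: D_def)
    show "\<forall>z\<in>D - {z \<in> int_lattice. x + z \<in> B}. k (x + z) = 0" using supp by (auto simp: D_def)
  qed
  moreover have "continuous_on (cbox 0 One) (\<lambda>x. \<Sum>z\<in>D. k (x + z))"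
    by (intro continuous_intros continuous_on_compose2[OF cont]) auto
  ultimately show "continuous_on (cbox 0 One) H" by (simp cong: continuous_on_cong_simp)
  show "H (x + z) = H x" if "z \<in> int_lattice" for x z
    unfolding H_def
    by (rule sum.reindex_bij_witness[of _ "\<lambda>y. y - z" "\<lambda>y. y + z"])
       (use that in \<open>auto simp: int_lattice_closed add_ac\<close>)
qed

section \<open>Density of continuous functions in L2\<close>

text \<open>For r > 0, the radial retraction onto the closed disc of radius r; the maximum in the
  denominator gives a single formula whose continuity is evident.\<close>

definition clamp_norm :: "real \<Rightarrow> complex \<Rightarrow> complex" where
  "clamp_norm r z = (r / max r (norm z)) *\<^sub>R z"

lemma norm_clamp_norm_le: "r > 0 \<Longrightarrow> norm (clamp_norm r z) \<le> r"
  by (simp add: clamp_norm_def field_simps max_def)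

lemma clamp_norm_id: "norm z \<le> r \<Longrightarrow> r > 0 \<Longrightarrow> clamp_norm r z = z"
  by (simp add: clamp_norm_def max_def)

lemma norm_diff_clamp_norm_le: "r > 0 \<Longrightarrow> norm (z - clamp_norm r z) \<le> norm z"
proof -
  assume r: "r > 0"
  define t where "t = r / max r (norm z)"
  have "max r (norm z) > 0" using r by (simp add: less_max_iff_disj)
  then have t: "0 \<le> t" "t \<le> 1" using r by (simp_all add: t_def divide_le_eq_1)
  have "z - clamp_norm r z = (1 - t) *\<^sub>R z" by (simp add: clamp_norm_def t_def scaleR_left_diff_distrib)
  then have "norm (z - clamp_norm r z) = (1 - t) * norm z" using t by simp
  also have "\<dots> \<le> norm z" using t by (simp add: mult_left_le_one_le)
  finally show ?thesis .
qed

lemma continuous_on_clamp_norm [continuous_intros]: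
  assumes "r > 0" "continuous_on S f"
  shows "continuous_on S (\<lambda>x. clamp_norm r (f x))"
proof -
  have "max r (norm z) > 0" for z :: complex using assms(1) by (simp add: less_max_iff_disj)
  then have "max r (norm z) \<noteq> 0" for z :: complex by (metis less_irrefl)
  then show ?thesis unfolding clamp_norm_def by (intro continuous_intros assms) auto
qed

lemma measurable_clamp_norm [measurable]:
  "r > 0 \<Longrightarrow> clamp_norm r \<in> borel_measurable borel"
  by (intro borel_measurable_continuous_onI continuous_on_clamp_norm continuous_intros)

lemma square_norm_add_le:
  fixes x y :: "'a::real_normed_vector"
  shows "(norm (x + y))\<^sup>2 \<le> 2 * (norm x)\<^sup>2 + 2 * (norm y)\<^sup>2"
proof -
  have "(norm (x + y))\<^sup>2 \<le> (norm x + norm y)\<^sup>2"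
    by (intro power_mono norm_triangle_ineq) simp
  also have "\<dots> \<le> 2 * (norm x)\<^sup>2 + 2 * (norm y)\<^sup>2"
    using sum_squares_bound[of "norm x" "norm y"] by (simp add: power2_sum)
  finally show ?thesis .
qed

text \<open>Bounded functions are approximated by truncating a sequence of continuous functions that converges
  almost everywhere and multiplying it with cut-off functions of \<open>\<Omega>\<close>.\<close>

lemma continuous_dense_L2_bounded:
  fixes f :: "'a::euclidean_space \<Rightarrow> complex"
  assumes f: "f \<in> borel_measurable (lebesgue_on \<Omega>)" and fin: "\<Omega> \<in> lmeasurable" and op: "open \<Omega>"
    and ne: "\<Omega> \<noteq> UNIV" and r: "r > 0" "\<And>x. norm (f x) \<le> r" and "\<epsilon> > 0"
  obtains G where "continuous_on UNIV G" "\<And>x. x \<notin> \<Omega> \<Longrightarrow> G x = 0" "\<And>x. norm (G x) \<le> r"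
    "(\<integral>x. (norm (f x - G x))\<^sup>2 \<partial>lebesgue_on \<Omega>) < \<epsilon>"
proof -
  have [measurable]: "f \<in> borel_measurable (lebesgue_on \<Omega>)" by fact
  have \<Omega>: "\<Omega> \<in> sets lebesgue" using fin by auto
  have "f measurable_on \<Omega>" using measurable_on_iff_borel_measurable[OF \<Omega>] f by blast
  then obtain Z h where Z: "negligible Z" and h: "\<And>n. continuous_on UNIV (h n)"
    and lim: "\<And>x. x \<notin> Z \<Longrightarrow> (\<lambda>n. h n x) \<longlonglongrightarrow> (if x \<in> \<Omega> then f x else 0)"
    unfolding measurable_on_def by blast
  \<comment> \<open>A cut-off that vanishes outside \<Omega> and, \<Omega> being open, eventually
    equals 1 at each point of \<Omega>.\<close>
  define \<eta> where "\<eta> n x = min 1 (real n * setdist {x} (- \<Omega>))" for n x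
  define G where "G n x = \<eta> n x *\<^sub>R clamp_norm r (h n x)" for n x
  have Gc: "continuous_on UNIV (G n)" for n
    unfolding G_def \<eta>_def using r by (intro continuous_intros h continuous_on_setdist)
  have G0: "G n x = 0" if "x \<notin> \<Omega>" for n x
    using that by (simp add: G_def \<eta>_def setdist_sing_in_set)
  have \<eta>01: "0 \<le> \<eta> n x" "\<eta> n x \<le> 1" for n x by (simp_all add: \<eta>_def setdist_pos_le)
  have Gb: "norm (G n x) \<le> r" for n x
    using mult_mono[OF \<eta>01(2) norm_clamp_norm_le[OF r(1), of "h n x"], of n x] \<eta>01(1)[of n x]
    by (simp add: G_def)
  have [measurable]: "G n \<in> borel_measurable (lebesgue_on \<Omega>)" for n
    by (rule continuous_imp_measurable_on_sets_lebesgue[OF continuous_on_subset[OF Gc] \<Omega>]) simp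
  have GL: "(\<lambda>n. G n x) \<longlonglongrightarrow> f x" if x: "x \<in> \<Omega>" "x \<notin> Z" for x
  proof -
    have "setdist {x} (- \<Omega>) > 0"
    proof -
      have "closed (- \<Omega>)" using op by (simp add: closed_def)
      \<comment> \<open>The distance to the empty set is 0 by convention, so the complement of
        \<Omega> has to be nonempty.\<close>
      then have "setdist {x} (- \<Omega>) \<noteq> 0" using x(1) ne by (auto simp: setdist_eq_0_sing_1)
      then show ?thesis using setdist_pos_le[of "{x}" "- \<Omega>"] by linarith
    qed
    then obtain n0 :: nat where n0: "1 < real n0 * setdist {x} (- \<Omega>)"
      using reals_Archimedean3 by blast
    have "\<eta> n x = 1" if "n \<ge> n0" for n
    proof -
      have "real n0 * setdist {x} (- \<Omega>) \<le> real n * setdist {x} (- \<Omega>)"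
        using that by (intro mult_right_mono) (auto simp: setdist_pos_le)
      then show ?thesis using n0 by (simp add: \<eta>_def)
    qed
    then have ev: "\<forall>\<^sub>F n in sequentially. clamp_norm r (h n x) = G n x"
      by (intro eventually_sequentiallyI[of n0]) (simp add: G_def)
    have "isCont (clamp_norm r) (f x)"
      using continuous_on_clamp_norm[OF r(1) continuous_on_id, of UNIV]
      by (simp add: continuous_on_eq_continuous_at id_def)
    then have "(\<lambda>n. clamp_norm r (h n x)) \<longlonglongrightarrow> clamp_norm r (f x)"
      by (rule isCont_tendsto_compose) (use lim[OF x(2)] x(1) in simp)
    then have "(\<lambda>n. clamp_norm r (h n x)) \<longlonglongrightarrow> f x"
      using clamp_norm_id[OF r(2) r(1)] by simp
    then show ?thesis using ev by (rule Lim_transform_eventually)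
  qed
  have AEZ: "AE x in lebesgue_on \<Omega>. x \<notin> Z"
  proof -
    have "AE x in lebesgue. x \<notin> Z" using Z unfolding negligible_iff_null_sets by (rule AE_not_in)
    then have "AE x in lebesgue. x \<in> \<Omega> \<longrightarrow> x \<notin> Z" by (rule eventually_mono) simp
    then show ?thesis using \<Omega> by (simp add: AE_restrict_space_iff)
  qed
  have "finite_measure (lebesgue_on \<Omega>)"
    using fin by (rule finite_measure_lebesgue_on)
  then interpret finite_measure "lebesgue_on \<Omega>" .
  have "(\<lambda>n. \<integral>x. (norm (f x - G n x))\<^sup>2 \<partial>lebesgue_on \<Omega>) \<longlonglongrightarrow> (\<integral>x. 0 \<partial>lebesgue_on \<Omega>)"
  proof (rule integral_dominated_convergence[where w = "\<lambda>_. (2 * r)\<^sup>2"])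
    show "AE x in lebesgue_on \<Omega>. (\<lambda>n. (norm (f x - G n x))\<^sup>2) \<longlonglongrightarrow> 0"
      using AEZ AE_space
    proof eventually_elim
      case (elim x)
      then have "(\<lambda>n. (norm (f x - G n x))\<^sup>2) \<longlonglongrightarrow> (norm (f x - f x))\<^sup>2"
        by (intro tendsto_intros GL) auto
      then show ?case by simp
    qed
    show "AE x in lebesgue_on \<Omega>. norm ((norm (f x - G n x))\<^sup>2) \<le> (2 * r)\<^sup>2" for n
    proof (rule AE_I2)
      fix x
      have "norm (f x - G n x) \<le> 2 * r"
        using norm_triangle_ineq4[of "f x" "G n x"] r(2)[of x] Gb[of n x] by linarith
      then have "(norm (f x - G n x))\<^sup>2 \<le> (2 * r)\<^sup>2" by (rule power_mono) simp
      then show "norm ((norm (f x - G n x))\<^sup>2) \<le> (2 * r)\<^sup>2" by simp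
    qed
  qed auto
  then have "\<forall>\<^sub>F n in sequentially. (\<integral>x. (norm (f x - G n x))\<^sup>2 \<partial>lebesgue_on \<Omega>) < \<epsilon>"
    using \<open>\<epsilon> > 0\<close> by (intro order_tendstoD(2)) auto
  then obtain n where "(\<integral>x. (norm (f x - G n x))\<^sup>2 \<partial>lebesgue_on \<Omega>) < \<epsilon>"
    by (auto simp: eventually_sequentially)
  then show thesis using that Gc G0 Gb by blast
qed

text \<open>Truncating \<open>f\<close> reduces to the bounded case, by dominated convergence with
  majorant the square of the norm of \<open>f\<close>. Each of the two errors may be \<epsilon>/4
  because the square of a sum is at most twice the sum of the squares.\<close>

lemma continuous_dense_L2:
  fixes f :: "'a::euclidean_space \<Rightarrow> complex"
  assumes f: "f \<in> L2_fun (lebesgue_on \<Omega>)" and fin: "\<Omega> \<in> lmeasurable" and op: "open \<Omega>"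
    and ne: "\<Omega> \<noteq> UNIV" and "\<epsilon> > 0"
  obtains G r where "continuous_on UNIV G" "\<And>x. x \<notin> \<Omega> \<Longrightarrow> G x = 0" "\<And>x. norm (G x) \<le> r"
    "(\<integral>x. (norm (f x - G x))\<^sup>2 \<partial>lebesgue_on \<Omega>) < \<epsilon>"
proof -
  have [measurable]: "f \<in> borel_measurable (lebesgue_on \<Omega>)"
    and int: "integrable (lebesgue_on \<Omega>) (\<lambda>x. (norm (f x))\<^sup>2)"
    using f by (auto simp: L2_fun_def)
  have \<Omega>: "\<Omega> \<in> sets lebesgue" using fin by auto
  have "finite_measure (lebesgue_on \<Omega>)"
    using fin by (rule finite_measure_lebesgue_on)
  then interpret finite_measure "lebesgue_on \<Omega>" .
  define F where "F n x = clamp_norm (real (Suc n)) (f x)" for n x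
  have [measurable]: "F n \<in> borel_measurable (lebesgue_on \<Omega>)" for n
    unfolding F_def by (rule measurable_compose[OF _ measurable_clamp_norm]) auto
  have "(\<lambda>n. \<integral>x. (norm (f x - F n x))\<^sup>2 \<partial>lebesgue_on \<Omega>) \<longlonglongrightarrow> (\<integral>x. 0 \<partial>lebesgue_on \<Omega>)"
  proof (rule integral_dominated_convergence[OF _ _ int])
    show "AE x in lebesgue_on \<Omega>. (\<lambda>n. (norm (f x - F n x))\<^sup>2) \<longlonglongrightarrow> 0"
    proof (rule AE_I2)
      fix x
      obtain n0 :: nat where "norm (f x) \<le> real n0" using real_arch_simple by blast
      then have "F n x = f x" if "n \<ge> n0" for n
        unfolding F_def using that by (intro clamp_norm_id) auto
      then show "(\<lambda>n. (norm (f x - F n x))\<^sup>2) \<longlonglongrightarrow> 0"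
        by (intro tendsto_eventually eventually_sequentiallyI[of n0]) simp
    qed
    show "AE x in lebesgue_on \<Omega>. norm ((norm (f x - F n x))\<^sup>2) \<le> (norm (f x))\<^sup>2" for n
      by (rule AE_I2) (auto simp: F_def intro!: power_mono norm_diff_clamp_norm_le)
  qed auto
  then have "\<forall>\<^sub>F n in sequentially. (\<integral>x. (norm (f x - F n x))\<^sup>2 \<partial>lebesgue_on \<Omega>) < \<epsilon> / 4"
    using \<open>\<epsilon> > 0\<close> by (intro order_tendstoD(2)) auto
  then obtain n where n: "(\<integral>x. (norm (f x - F n x))\<^sup>2 \<partial>lebesgue_on \<Omega>) < \<epsilon> / 4"
    by (auto simp: eventually_sequentially)
  define r where "r = real (Suc n)"
  have r: "r > 0" by (simp add: r_def)
  have Fb: "norm (F n x) \<le> r" for x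
    unfolding F_def r_def by (rule norm_clamp_norm_le) simp
  obtain G where G: "continuous_on UNIV G" "\<And>x. x \<notin> \<Omega> \<Longrightarrow> G x = 0" "\<And>x. norm (G x) \<le> r"
    "(\<integral>x. (norm (F n x - G x))\<^sup>2 \<partial>lebesgue_on \<Omega>) < \<epsilon> / 4"
    by (rule continuous_dense_L2_bounded[of "F n" \<Omega> "r" "\<epsilon> / 4"])
       (use fin op ne Fb r \<open>\<epsilon> > 0\<close> in auto)
  have [measurable]: "G \<in> borel_measurable (lebesgue_on \<Omega>)"
    by (rule continuous_imp_measurable_on_sets_lebesgue[OF continuous_on_subset[OF G(1)] \<Omega>]) simp
  have i1: "integrable (lebesgue_on \<Omega>) (\<lambda>x. (norm (f x - F n x))\<^sup>2)"
    by (rule Bochner_Integration.integrable_bound[OF int])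
       (auto simp: F_def intro!: power_mono norm_diff_clamp_norm_le)
  have i2: "integrable (lebesgue_on \<Omega>) (\<lambda>x. (norm (F n x - G x))\<^sup>2)"
  proof (rule integrable_const_bound[where B = "(2 * r)\<^sup>2"])
    show "AE x in lebesgue_on \<Omega>. norm ((norm (F n x - G x))\<^sup>2) \<le> (2 * r)\<^sup>2"
    proof (rule AE_I2)
      fix x
      have "norm (F n x - G x) \<le> 2 * r"
        using norm_triangle_ineq4[of "F n x" "G x"] Fb[of x] G(3)[of x] by linarith
      then have "(norm (F n x - G x))\<^sup>2 \<le> (2 * r)\<^sup>2" by (rule power_mono) simp
      then show "norm ((norm (F n x - G x))\<^sup>2) \<le> (2 * r)\<^sup>2" by simp
    qed
  qed auto
  have "(\<integral>x. (norm (f x - G x))\<^sup>2 \<partial>lebesgue_on \<Omega>)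
      \<le> (\<integral>x. 2 * (norm (f x - F n x))\<^sup>2 + 2 * (norm (F n x - G x))\<^sup>2 \<partial>lebesgue_on \<Omega>)"
  proof (rule integral_mono_AE')
    show "AE x in lebesgue_on \<Omega>. (norm (f x - G x))\<^sup>2 \<le> 2 * (norm (f x - F n x))\<^sup>2 + 2 * (norm (F n x - G x))\<^sup>2"
    proof (rule AE_I2)
      fix x
      show "(norm (f x - G x))\<^sup>2 \<le> 2 * (norm (f x - F n x))\<^sup>2 + 2 * (norm (F n x - G x))\<^sup>2"
        using square_norm_add_le[of "f x - F n x" "F n x - G x"] by simp
    qed
  qed (use i1 i2 in auto)
  also have "\<dots> = 2 * (\<integral>x. (norm (f x - F n x))\<^sup>2 \<partial>lebesgue_on \<Omega>) + 2 * (\<integral>x. (norm (F n x - G x))\<^sup>2 \<partial>lebesgue_on \<Omega>)"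
    using i1 i2 by simp
  also have "\<dots> < \<epsilon>" using n G(4) by linarith
  finally show thesis using that G by blast
qed

section \<open>The spectrum of three cubes in normal form\<close>

text \<open>Three distinct numbers with the same cube c are all the roots of T^3 - c, whose
  coefficient at T^2 is 0.\<close>

lemma sum_eq_0_of_cubes_eq:
  fixes x y z :: complex
  assumes "x ^ 3 = y ^ 3" "x ^ 3 = z ^ 3" "x \<noteq> y" "x \<noteq> z" "y \<noteq> z"
  shows "x + y + z = 0"
proof -
  have "(x - y) * (x\<^sup>2 + x * y + y\<^sup>2) = 0" "(x - z) * (x\<^sup>2 + x * z + z\<^sup>2) = 0"
    using assms(1,2) by (simp_all add: power2_eq_square power3_eq_cube algebra_simps)
  then have "x\<^sup>2 + x * y + y\<^sup>2 = 0" "x\<^sup>2 + x * z + z\<^sup>2 = 0" using assms(3,4) by simp_all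
  then have "(x\<^sup>2 + x * y + y\<^sup>2) - (x\<^sup>2 + x * z + z\<^sup>2) = 0" by simp
  then have "(y - z) * (x + y + z) = 0" by (simp add: power2_eq_square algebra_simps)
  then show ?thesis using assms(5) by simp
qed

lemma expo_of_nat: "expo (of_nat n *\<^sub>R l) x = expo l x ^ n"
  by (induction n) (simp_all add: scaleR_left_distrib expo_add)

lemma borel_measurable_expo [measurable]: "expo \<mu> \<in> borel_measurable borel"
  by (intro borel_measurable_continuous_onI continuous_on_expo)

section \<open>Fourier integrals of unit cubes\<close>

definition expo_integral :: "'a::euclidean_space \<Rightarrow> 'a set \<Rightarrow> complex" where
  "expo_integral \<mu> A = (\<integral>x. indicator A x *\<^sub>R expo \<mu> x \<partial>lborel)"

lemma expo_integral_translate: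
  fixes A :: "'a::euclidean_space set"
  assumes [measurable]: "A \<in> sets borel"
  shows "expo_integral \<mu> ((\<lambda>x. x + v) -` A) = expo \<mu> (- v) * expo_integral \<mu> A"
proof -
  have "expo_integral \<mu> A = (\<integral>x. indicator A x *\<^sub>R expo \<mu> x \<partial>distr lborel borel ((+) v))"
    by (simp add: lborel_distr_plus expo_integral_def)
  also have "\<dots> = (\<integral>x. indicator A (v + x) *\<^sub>R expo \<mu> (v + x) \<partial>lborel)"
    by (rule integral_distr) measurable
  also have "\<dots> = (\<integral>x. expo \<mu> v * (indicator ((\<lambda>x. x + v) -` A) x *\<^sub>R expo \<mu> x) \<partial>lborel)"
    by (intro Bochner_Integration.integral_cong refl) (simp add: expo_add_right indicator_def add.commute)
  also have "\<dots> = expo \<mu> v * expo_integral \<mu> ((\<lambda>x. x + v) -` A)"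
    unfolding expo_integral_def by (rule integral_mult_right_zero)
  finally have "expo \<mu> (- v) * expo_integral \<mu> A = (expo \<mu> (- v) * expo \<mu> v) * expo_integral \<mu> ((\<lambda>x. x + v) -` A)"
    by (simp only: mult.assoc)
  also have "expo \<mu> (- v) * expo \<mu> v = 1" by (simp add: expo_add_right[symmetric] expo_commute[of \<mu> 0])
  finally show ?thesis by simp
qed

lemma expo_integral_Un:
  fixes A B :: "'a::euclidean_space set"
  assumes [measurable]: "A \<in> sets borel" "B \<in> sets borel" and bd: "bounded A" "bounded B" and disj: "A \<inter> B = {}"
  shows "expo_integral \<mu> (A \<union> B) = expo_integral \<mu> A + expo_integral \<mu> B"
proof -
  have int: "integrable lborel (\<lambda>x. indicator C x *\<^sub>R expo \<mu> x)" if [measurable]: "C \<in> sets borel" and "bounded C" for C :: "'a set"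
  proof (rule integrableI_bounded)
    have "(\<integral>\<^sup>+ x. ennreal (norm (indicator C x *\<^sub>R expo \<mu> x)) \<partial>lborel) = (\<integral>\<^sup>+ x. indicator C x \<partial>lborel)"
      by (intro nn_integral_cong) (simp add: indicator_def)
    also have "\<dots> < \<infinity>" using emeasure_bounded_finite[OF that(2)] by simp
    finally show "(\<integral>\<^sup>+ x. ennreal (norm (indicator C x *\<^sub>R expo \<mu> x)) \<partial>lborel) < \<infinity>" .
  qed measurable
  have "expo_integral \<mu> (A \<union> B) = (\<integral>x. indicator A x *\<^sub>R expo \<mu> x + indicator B x *\<^sub>R expo \<mu> x \<partial>lborel)"
    unfolding expo_integral_def using disj
    by (intro Bochner_Integration.integral_cong refl) (auto simp: indicator_def)
  then show ?thesis
    using int assms by (simp add: expo_integral_def)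
qed

text \<open>The integral over a period is invariant under translation, but translation by half a period
  of \<open>expo \<mu>\<close> reverses its sign.\<close>

lemma expo_integral_unit_cube_eq_0:
  fixes a :: "'a::euclidean_space"
  assumes i: "i \<in> Basis" and \<mu>: "\<mu> \<bullet> i \<in> \<int>" "\<mu> \<bullet> i \<noteq> 0"
  shows "expo_integral \<mu> (unit_cube a) = 0"
proof -
  \<comment> \<open>Half-open in direction \<open>i\<close>, so that adjacent slabs join without gap
    or overlap; the slab of length 1 differs from the cube by part of a hyperplane.\<close>
  define slab where "slab s t = {x. s \<le> x \<bullet> i \<and> x \<bullet> i < t \<and> (\<forall>j\<in>Basis - {i}. a \<bullet> j < x \<bullet> j \<and> x \<bullet> j < a \<bullet> j + 1)}" for s t
  define J where "J s t = expo_integral \<mu> (slab s t)" for s t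
  have [measurable]: "slab s t \<in> sets borel" for s t unfolding slab_def by measurable
  have bd: "bounded (slab s t)" for s t
  proof (rule bounded_subset[OF bounded_cbox])
    show "slab s t \<subseteq> cbox (\<Sum>j\<in>Basis. (if j = i then s else a \<bullet> j) *\<^sub>R j) (\<Sum>j\<in>Basis. (if j = i then t else a \<bullet> j + 1) *\<^sub>R j)"
      by (auto simp: slab_def mem_box less_imp_le)
  qed
  have join: "J r t = J r s + J s t" if "r \<le> s" "s \<le> t" for r s t
  proof -
    have "slab r t = slab r s \<union> slab s t" using that by (auto simp: slab_def)
    moreover have "slab r s \<inter> slab s t = {}" by (auto simp: slab_def)
    ultimately show ?thesis unfolding J_def using expo_integral_Un[OF _ _ bd bd] by simp
  qed
  have shift: "J s t = expo \<mu> (- (h *\<^sub>R i)) * J (s + h) (t + h)" for s t h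
  proof -
    have "(\<lambda>x. x + h *\<^sub>R i) -` slab (s + h) (t + h) = slab s t"
      using i by (auto simp: slab_def inner_add_left inner_Basis)
    then show ?thesis unfolding J_def using expo_integral_translate[of "slab (s + h) (t + h)" \<mu> "h *\<^sub>R i"] by simp
  qed
  obtain n :: int where n: "\<mu> \<bullet> i = of_int n" "n \<noteq> 0" using \<mu> by (auto elim!: Ints_cases)
  \<comment> \<open>Half the period of \<open>expo \<mu>\<close> in direction
    \<open>i\<close>.\<close>
  define \<theta> where "\<theta> = 1 / (2 * \<bar>real_of_int n\<bar>)"
  have \<theta>: "0 < \<theta>" "\<theta> \<le> 1"
  proof -
    have "\<bar>real_of_int n\<bar> \<ge> 1" using n(2) by linarith
    then show "0 < \<theta>" "\<theta> \<le> 1" by (auto simp: \<theta>_def divide_simps)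
  qed
  have half: "expo \<mu> (- (\<theta> *\<^sub>R i)) = - 1"
  proof (cases "n > 0")
    case True
    then have "\<mu> \<bullet> (- (\<theta> *\<^sub>R i)) = - (1 / 2)" by (simp add: n \<theta>_def)
    then have "expo \<mu> (- (\<theta> *\<^sub>R i)) = cis (2 * pi * - (1 / 2))" unfolding expo_eq_cis by (simp only:)
    then show ?thesis by (simp add: complex_eq_iff)
  next
    case False
    then have "\<mu> \<bullet> (- (\<theta> *\<^sub>R i)) = 1 / 2" using n(2) by (simp add: n \<theta>_def field_simps)
    then have "expo \<mu> (- (\<theta> *\<^sub>R i)) = cis (2 * pi * (1 / 2))" unfolding expo_eq_cis by (simp only:)
    then show ?thesis by simp
  qed
  have one: "expo \<mu> (- (1 *\<^sub>R i)) = 1"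
    unfolding expo_eq_1_iff using \<mu>(1) by simp
  let ?s = "a \<bullet> i"
  have "J ?s (?s + 1) = J ?s (?s + \<theta>) + J (?s + \<theta>) (?s + 1)"
    using \<theta> by (intro join) auto
  also have "J ?s (?s + \<theta>) = J (?s + 1) (?s + 1 + \<theta>)"
    using shift[of ?s "?s + \<theta>" 1] one by (simp add: add_ac)
  also have "J (?s + 1) (?s + 1 + \<theta>) + J (?s + \<theta>) (?s + 1) = J (?s + \<theta>) (?s + 1 + \<theta>)"
    using join[of "?s + \<theta>" "?s + 1" "?s + 1 + \<theta>"] \<theta> by simp
  also have "\<dots> = - J ?s (?s + 1)"
    using shift[of ?s "?s + 1" \<theta>] half by (simp add: add_ac)
  finally have J0: "J ?s (?s + 1) = 0" by simp
  have "AE x in lborel. x \<bullet> i \<noteq> ?s"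
  proof -
    have "AE x in lebesgue. x \<notin> {x. x \<bullet> i = ?s}"
      using negligible_standard_hyperplane[OF i, of ?s] unfolding negligible_iff_null_sets by (rule AE_not_in)
    then show ?thesis by (simp add: AE_completion_iff)
  qed
  then have "expo_integral \<mu> (unit_cube a) = J ?s (?s + 1)"
    unfolding J_def expo_integral_def
  proof (intro integral_cong_AE)
    have [measurable]: "unit_cube a \<in> sets borel" by (simp add: unit_cube_eq_box)
    show "(\<lambda>x. indicator (unit_cube a) x *\<^sub>R expo \<mu> x) \<in> borel_measurable lborel" by measurable
    show "(\<lambda>x. indicator (slab ?s (?s + 1)) x *\<^sub>R expo \<mu> x) \<in> borel_measurable lborel" by measurable
    assume "AE x in lborel. x \<bullet> i \<noteq> ?s"
    then show "AE x in lborel. indicator (unit_cube a) x *\<^sub>R expo \<mu> x = indicator (slab ?s (?s + 1)) x *\<^sub>R expo \<mu> x"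
    proof eventually_elim
      case (elim x)
      have "(\<forall>j\<in>Basis. Q j) \<longleftrightarrow> Q i \<and> (\<forall>j\<in>Basis - {i}. Q j)" for Q using i by auto
      then have "x \<in> unit_cube a \<longleftrightarrow> x \<in> slab ?s (?s + 1)"
        using elim unfolding mem_unit_cube slab_def by auto
      then show ?case by (simp add: indicator_def)
    qed
  qed
  then show ?thesis using J0 by simp
qed

lemma expo_integral_unit_cube: "expo_integral \<mu> (unit_cube a) = expo \<mu> a * expo_integral \<mu> (unit_cube 0)"
proof -
  have "(\<lambda>x. x + (- a)) -` unit_cube 0 = unit_cube a"
    by (auto simp: mem_unit_cube inner_diff_left algebra_simps)
  then show ?thesis
    using expo_integral_translate[of "unit_cube 0" \<mu> "- a"] by (simp add: unit_cube_eq_box)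
qed

lemma integral_lebesgue_on_expo:
  assumes [measurable]: "S \<in> sets borel"
  shows "(\<integral>x. expo \<mu> x \<partial>lebesgue_on S) = expo_integral \<mu> S"
  by (simp add: integral_restrict_space expo_integral_def integral_completion)

section \<open>Completeness of the exponentials of the spectrum\<close>

context three_cubes begin

definition dual_shear :: "'a \<Rightarrow> 'a" where
  "dual_shear \<xi> = \<xi> - (\<rho> * (\<xi> \<bullet> e)) *\<^sub>R g"

definition unshear :: "'a \<Rightarrow> 'a" where
  "unshear y = y + (\<rho> * (y \<bullet> g)) *\<^sub>R e"

definition step :: 'a where
  "step = (1 / (3 * real_of_int N)) *\<^sub>R e"

definition spectrum :: "'a set" where
  "spectrum = (\<lambda>(n, j). dual_shear (n + of_nat j *\<^sub>R step)) ` (int_lattice \<times> {..<3::nat})"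

lemma dual_shear_linear:
  "dual_shear (x + y) = dual_shear x + dual_shear y" "dual_shear (x - y) = dual_shear x - dual_shear y"
  by (simp_all add: dual_shear_def algebra_simps inner_add_left inner_diff_left)

lemma inner_dual_shear: "dual_shear \<xi> \<bullet> x = \<xi> \<bullet> shear x"
  by (simp add: dual_shear_def shear_def inner_diff_left inner_diff_right inner_commute algebra_simps)

lemma expo_dual_shear: "expo (dual_shear \<xi>) x = expo \<xi> (shear x)"
  by (simp add: expo_def inner_dual_shear)

lemma unshear_shear [simp]: "unshear (shear x) = x"
  by (simp add: unshear_def shear_inner_g) (simp add: shear_def)

lemma shear_unshear [simp]: "shear (unshear y) = y"
  by (simp add: shear_def unshear_def inner_add_left algebra_simps)

lemma countable_spectrum: "countable spectrum"
  unfolding spectrum_def by (intro countable_image countable_SIGMA countable_int_lattice) auto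

lemma step_inner: "step \<bullet> z = (z \<bullet> e) / (3 * of_int N)"
  by (simp add: step_def inner_commute)

text \<open>The inner product of \<open>step\<close> with z is (\<kappa> i - \<kappa> j)/3, not an
  integer, so the summands are the powers 1, t, t^2 of a primitive cube root of unity.\<close>

lemma cube_root_sum_0:
  assumes ij: "i < 3" "j < 3" "i \<noteq> j" and z: "z \<bullet> e = of_int (N * (\<kappa> i - \<kappa> j))"
  shows "(\<Sum>m<3::nat. expo (- (of_nat m *\<^sub>R step)) z) = 0"
proof -
  define t where "t = expo (- step) z"
  have in3: "(- step) \<bullet> z = - of_int (\<kappa> i - \<kappa> j) / 3"
    using N z by (simp add: step_inner field_simps)
  have "t \<noteq> 1"
  proof
    assume "t = 1"
    then obtain k where "- of_int (\<kappa> i - \<kappa> j) / 3 = real_of_int k"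
      unfolding t_def expo_eq_1_iff in3 by (auto elim: Ints_cases)
    then have "real_of_int (\<kappa> j - \<kappa> i) = of_int (3 * k)" by simp
    then have "\<kappa> j - \<kappa> i = 3 * k" by (simp only: of_int_eq_iff)
    then have "\<kappa> j mod 3 = \<kappa> i mod 3" by (simp add: mod_eq_dvd_iff)
    then show False using \<kappa>[OF ij(1,2,3)] by simp
  qed
  have "t ^ 3 = 1"
  proof -
    have "(of_nat 3 *\<^sub>R (- step)) \<bullet> z = 3 * ((- step) \<bullet> z)" by simp
    also have "\<dots> = of_int (\<kappa> j - \<kappa> i)" unfolding in3 by simp
    finally have "(of_nat 3 *\<^sub>R (- step)) \<bullet> z = of_int (\<kappa> j - \<kappa> i)" .
    then have "expo (of_nat 3 *\<^sub>R (- step)) z = 1" unfolding expo_eq_1_iff by (simp only: Ints_of_int)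
    then show ?thesis unfolding t_def expo_of_nat .
  qed
  then have "(t - 1) * (1 + t + t\<^sup>2) = 0" by (simp add: power2_eq_square power3_eq_cube algebra_simps)
  then have "1 + t + t\<^sup>2 = 0" using \<open>t \<noteq> 1\<close> by simp
  moreover have "expo (- (of_nat m *\<^sub>R step)) z = t ^ m" for m
    using expo_of_nat[of m "- step" z] by (simp add: t_def)
  ultimately show ?thesis by (simp add: numeral_3_eq_3 power2_eq_square)
qed

lemma bounded_linear_shear: "bounded_linear shear"
  unfolding shear_def
  by (intro bounded_linear_sub bounded_linear_ident bounded_linear_scaleR_left[THEN bounded_linear_compose]
      bounded_linear_const_mult bounded_linear_inner_left)

lemma expo_span_shear:
  assumes "expo_span A q"
  shows "expo_span (dual_shear ` A) (\<lambda>x. q (shear x))"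
proof -
  obtain F c where F: "finite F" "F \<subseteq> A" "q = (\<lambda>x. \<Sum>l\<in>F. c l * expo l x)"
    using assms unfolding expo_span_def by blast
  have "(\<lambda>x. q (shear x)) = (\<lambda>x. \<Sum>l\<in>F. c l * expo (dual_shear l) x)"
    by (simp add: F(3) expo_dual_shear)
  moreover have "expo_span (dual_shear ` A) (\<lambda>x. \<Sum>l\<in>F. c l * expo (dual_shear l) x)"
    using F by (intro expo_span_sum expo_span_single) auto
  ultimately show ?thesis by simp
qed

text \<open>The components \<open>H m\<close> of \<open>G\<close> are the discrete Fourier coefficients of \<open>G\<close> along the three points of
  \<open>\<Omega>\<close> that lie over the same point of the torus.\<close>

lemma uniform_approximation_by_spectrum:
  fixes G :: "'a \<Rightarrow> complex"
  assumes cont: "continuous_on UNIV G" and supp: "\<And>x. x \<notin> \<Omega> \<Longrightarrow> G x = 0" and bd: "bounded \<Omega>" and "\<epsilon> > 0"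
  obtains q where "expo_span spectrum q" "\<And>x. x \<in> \<Omega> \<Longrightarrow> norm (G x - q x) < \<epsilon>"
proof -
  define B where "B = shear ` \<Omega>"
  have B: "bounded B" unfolding B_def by (rule bounded_linear_image[OF bd bounded_linear_shear])
  have B_iff: "y \<in> B \<longleftrightarrow> unshear y \<in> \<Omega>" for y
  proof
    assume "y \<in> B"
    then show "unshear y \<in> \<Omega>" by (auto simp: B_def)
  next
    assume "unshear y \<in> \<Omega>"
    then have "shear (unshear y) \<in> B" unfolding B_def by (rule imageI)
    then show "y \<in> B" by simp
  qed
  \<comment> \<open>Modulating by the frequency -m \<open>step\<close> moves the m-th coset of the
    spectrum to the integer lattice, where periodization and trigonometric approximation apply. The
    factor 1/3 averages over the three characters.\<close>
  define k where "k m y = (1 / 3) * G (unshear y) * expo (- (of_nat m *\<^sub>R step)) y" for m :: nat and y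
  define H where "H m y = (\<Sum>z | z \<in> int_lattice \<and> y + z \<in> B. k m (y + z))" for m y
  have kc: "continuous_on UNIV (k m)" for m
    unfolding k_def unshear_def
    by (intro continuous_intros continuous_on_compose2[OF cont]) auto
  have k0: "k m y = 0" if "y \<notin> B" for m y
    using supp that by (simp add: k_def B_iff)
  have "\<exists>q. expo_span int_lattice q \<and> (\<forall>y. norm (H m y - q y) < \<epsilon> / 3)" for m
  proof -
    have "continuous_on (cbox 0 One) (H m)" "\<And>x z. z \<in> int_lattice \<Longrightarrow> H m (x + z) = H m x"
      unfolding H_def using periodization[OF kc[of m] B k0] by auto
    then show ?thesis
      using trigonometric_approximation[of "H m" "\<epsilon> / 3"] \<open>\<epsilon> > 0\<close> by (metis zero_less_divide_iff zero_less_numeral)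
  qed
  then obtain p where p: "\<And>m. expo_span int_lattice (p m)" "\<And>m y. norm (H m y - p m y) < \<epsilon> / 3"
    by metis
  define q where "q x = (\<Sum>m<3::nat. p m (shear x) * expo (dual_shear (of_nat m *\<^sub>R step)) x)" for x
  have "expo_span spectrum q"
    unfolding q_def
  proof (rule expo_span_sum)
    fix m :: nat assume m: "m \<in> {..<3}"
    have "expo_span {dual_shear (of_nat m *\<^sub>R step)} (\<lambda>x. expo (dual_shear (of_nat m *\<^sub>R step)) x)"
      using expo_span_single[of "dual_shear (of_nat m *\<^sub>R step)" _ 1] by simp
    then show "expo_span spectrum (\<lambda>x. p m (shear x) * expo (dual_shear (of_nat m *\<^sub>R step)) x)"
      by (rule expo_span_mult[OF expo_span_shear[OF p(1)]])
         (use m in \<open>auto simp: spectrum_def dual_shear_linear[symmetric] intro!: rev_image_eqI\<close>)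
  qed simp
  moreover have "norm (G x - q x) < \<epsilon>" if x: "x \<in> \<Omega>" for x
  proof -
    define y where "y = shear x"
    define Z where "Z = {z \<in> int_lattice. y + z \<in> B}"
    have "Z \<subseteq> int_lattice \<inter> (\<Union>b\<in>B. \<Union>c\<in>{y}. {b - c})" by (force simp: Z_def)
    moreover have "finite (int_lattice \<inter> (\<Union>b\<in>B. \<Union>c\<in>{y}. {b - c}))"
      by (rule finite_int_lattice_bounded, rule bounded_differences[OF B]) simp
    ultimately have "finite Z" by (rule finite_subset)
    have "0 \<in> Z" using x by (simp add: Z_def y_def B_def int_lattice_closed)
    obtain i where i: "i < 3" "x \<in> unit_cube (w i)" using x by (auto simp: \<Omega>)
    \<comment> \<open>Besides x itself, every point of \<Omega> over the same point of the torus
      lies in another cube, so summing over m cancels it and recovers G x.\<close>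
    have zero: "(\<Sum>m<3::nat. expo (- (of_nat m *\<^sub>R step)) z) = 0" if "z \<in> Z" "z \<noteq> 0" for z
    proof -
      define x' where "x' = unshear (y + z)"
      have "x' \<in> \<Omega>" using that by (simp add: Z_def x'_def B_iff)
      then obtain j where j: "j < 3" "x' \<in> unit_cube (w j)" by (auto simp: \<Omega>)
      have z: "shear (x' - x) = z" by (simp add: shear_linear x'_def y_def)
      then have L: "shear (x' - x) \<in> int_lattice" using that by (simp add: Z_def)
      have "j \<noteq> i"
      proof
        assume "j = i"
        then have "x' = x" using shear_lattice_difference(2)[OF j(1) i(1) j(2) i(2) L] by blast
        then show False using z that(2) by (simp add: shear_def)
      qed
      then show ?thesis
        using cube_root_sum_0[OF j(1) i(1), of z] shear_lattice_difference(1)[OF j(1) i(1) j(2) i(2) L] z by simp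
    qed
    have "(\<Sum>m<3::nat. H m y * expo (of_nat m *\<^sub>R step) y)
      = (\<Sum>m<3::nat. \<Sum>z\<in>Z. (1 / 3) * G (unshear (y + z)) * expo (- (of_nat m *\<^sub>R step)) z)"
    proof (intro sum.cong refl)
      fix m :: nat
      have "expo (- (of_nat m *\<^sub>R step)) (y + z) * expo (of_nat m *\<^sub>R step) y = expo (- (of_nat m *\<^sub>R step)) z" for z
        using expo_add[of "- (of_nat m *\<^sub>R step)" "of_nat m *\<^sub>R step" y] by (simp add: expo_add_right)
      then show "H m y * expo (of_nat m *\<^sub>R step) y = (\<Sum>z\<in>Z. (1 / 3) * G (unshear (y + z)) * expo (- (of_nat m *\<^sub>R step)) z)"
        unfolding H_def k_def Z_def[symmetric] by (simp add: sum_distrib_right mult.assoc)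
    qed
    also have "\<dots> = (\<Sum>z\<in>Z. (1 / 3) * G (unshear (y + z)) * (\<Sum>m<3::nat. expo (- (of_nat m *\<^sub>R step)) z))"
      by (subst sum.swap) (simp add: sum_distrib_left)
    also have "\<dots> = (\<Sum>z\<in>{0}. (1 / 3) * G (unshear (y + z)) * (\<Sum>m<3::nat. expo (- (of_nat m *\<^sub>R step)) z))"
      by (rule sum.mono_neutral_right[OF \<open>finite Z\<close>]) (use \<open>0 \<in> Z\<close> zero in auto)
    also have "\<dots> = G x"
      by (simp add: y_def expo_commute[of _ 0])
    finally have "G x - q x = (\<Sum>m<3::nat. (H m y - p m y) * expo (of_nat m *\<^sub>R step) y)"
      by (simp add: q_def expo_dual_shear y_def[symmetric] left_diff_distrib sum_subtractf)
    also have "norm \<dots> \<le> (\<Sum>m<3::nat. norm (H m y - p m y))"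
      by (rule order_trans[OF norm_sum]) (simp add: norm_mult)
    also have "\<dots> < (\<Sum>m<3::nat. \<epsilon> / 3)"
      by (rule sum_strict_mono) (use p(2) in \<open>simp_all add: lessThan_empty_iff\<close>)
    also have "\<dots> = \<epsilon>" by simp
    finally show ?thesis .
  qed
  ultimately show thesis using that by blast
qed

section \<open>Orthogonality of the exponentials of the spectrum\<close>

lemma disjoint_cubes:
  assumes "i < 3" "j < 3" "i \<noteq> j"
  shows "unit_cube (w i) \<inter> unit_cube (w j) = {}"
proof (rule ccontr)
  assume "\<not> ?thesis"
  then obtain x where x: "x \<in> unit_cube (w i)" "x \<in> unit_cube (w j)" by blast
  have "shear (x - x) \<in> int_lattice" by (simp add: shear_def int_lattice_closed)
  from shear_lattice_difference(1)[OF assms(1,2) x this] have "N * (\<kappa> i - \<kappa> j) = 0"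
    by (simp add: shear_def flip: of_int_mult of_int_diff)
  then show False using N \<kappa>[OF assms] by auto
qed

lemma expo_integral_\<Omega>: "expo_integral \<mu> \<Omega> = (\<Sum>i<3. expo \<mu> (w i)) * expo_integral \<mu> (unit_cube 0)"
proof -
  have "\<Omega> = unit_cube (w 0) \<union> unit_cube (w 1) \<union> unit_cube (w 2)"
    unfolding \<Omega> by (auto simp: numeral_3_eq_3 lessThan_Suc numeral_2_eq_2)
  moreover have "expo_integral \<mu> (unit_cube (w 0) \<union> unit_cube (w 1) \<union> unit_cube (w 2)) =
      expo_integral \<mu> (unit_cube (w 0)) + expo_integral \<mu> (unit_cube (w 1)) + expo_integral \<mu> (unit_cube (w 2))"
    using disjoint_cubes[of 0 1] disjoint_cubes[of 0 2] disjoint_cubes[of 1 2]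
    by (subst expo_integral_Un) (auto simp: unit_cube_eq_box expo_integral_Un bounded_box)
  ultimately show ?thesis
    by (simp add: expo_integral_unit_cube[of \<mu> "w _"] numeral_3_eq_3 numeral_2_eq_2 distrib_right)
qed

text \<open>Modulo integers, the inner product of \<open>\<mu>\<close> with w i - w 0 is m \<kappa>
  i / 3. As m is invertible modulo 3, the three exponentials are distinct numbers with the same
  cube.\<close>

lemma expo_sum_0:
  assumes n: "n \<in> int_lattice" and m: "m mod 3 \<noteq> (0::int)"
    and \<mu>: "\<mu> = dual_shear (n + of_int m *\<^sub>R step)"
    and no: "\<And>b. b \<in> Basis \<Longrightarrow> \<mu> \<bullet> b \<in> \<int> \<Longrightarrow> \<mu> \<bullet> b = 0"
  shows "(\<Sum>i<3. expo \<mu> (w i)) = 0"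
proof -
  have nb: "n \<bullet> b = 0" if b: "b \<in> Basis" "b \<noteq> e" "b \<noteq> g" for b
  proof -
    have "\<mu> \<bullet> b = n \<bullet> b"
      using b e g by (auto simp: \<mu> dual_shear_def step_def inner_diff_left inner_add_left inner_Basis)
    then show ?thesis using no[OF b(1)] n b(1) by (simp add: int_lattice_def)
  qed
  have key: "\<exists>k::int. \<mu> \<bullet> (w i - w 0) = of_int k + of_int m * of_int (\<kappa> i) / 3" if i: "i < 3" for i
  proof -
    \<comment> \<open>The sheared displacement without its e-component. Its g-coordinate is an
      integer; on further axes it may be arbitrary, but there n vanishes by \<open>nb\<close>, so n
      \<bullet> \<delta> is an integer.\<close>
    define \<delta> where "\<delta> = shear (w i - w 0) - of_int (N * \<kappa> i) *\<^sub>R e"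
    have \<delta>e: "\<delta> \<bullet> e = 0" using we[OF i] by (simp add: \<delta>_def inner_diff_left shear_inner_e)
    have "n \<bullet> \<delta> \<in> \<int>"
    proof -
      have "(n \<bullet> b) * (\<delta> \<bullet> b) \<in> \<int>" if b: "b \<in> Basis" for b
      proof -
        consider "b = e" | "b \<noteq> e" "b \<noteq> g" | "b = g" by blast
        then show ?thesis
        proof cases
          case 1 then show ?thesis using \<delta>e by simp
        next
          case 2 then show ?thesis using nb[OF b] by simp
        next
          case 3
          have "\<delta> \<bullet> g = (w i - w 0) \<bullet> g" by (simp add: \<delta>_def inner_diff_left shear_inner_g)
          then show ?thesis using 3 wg[OF i] n b by (auto simp: int_lattice_def intro!: Ints_mult)
        qed
      qed
      then show ?thesis by (subst euclidean_inner) (auto intro: Ints_sum)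
    qed
    then obtain k :: int where k: "n \<bullet> \<delta> = of_int k" by (auto elim: Ints_cases)
    have s\<delta>: "step \<bullet> \<delta> = 0" using \<delta>e by (simp add: step_inner)
    have "\<mu> \<bullet> (w i - w 0) = (n + of_int m *\<^sub>R step) \<bullet> (\<delta> + of_int (N * \<kappa> i) *\<^sub>R e)"
      by (simp add: \<mu> inner_dual_shear \<delta>_def)
    also have "\<dots> = n \<bullet> \<delta> + of_int (N * \<kappa> i) * (n \<bullet> e) + of_int m * of_int (\<kappa> i) / 3"
      using s\<delta> N by (simp add: inner_add_left inner_add_right step_def field_simps)
    finally have eq: "\<mu> \<bullet> (w i - w 0) = of_int k + of_int (N * \<kappa> i) * (n \<bullet> e) + of_int m * of_int (\<kappa> i) / 3"
      by (simp add: k)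
    obtain k' :: int where "n \<bullet> e = of_int k'" using n e by (auto simp: int_lattice_def elim: Ints_cases)
    then have "\<mu> \<bullet> (w i - w 0) = of_int (k + N * \<kappa> i * k') + of_int m * of_int (\<kappa> i) / 3"
      using eq by simp
    then show ?thesis by blast
  qed
  have diff: "\<exists>k::int. \<mu> \<bullet> (w i - w j) = of_int (3 * k + m * (\<kappa> i - \<kappa> j)) / 3" if ij: "i < 3" "j < 3" for i j
  proof -
    obtain k l :: int where "\<mu> \<bullet> (w i - w 0) = of_int k + of_int m * of_int (\<kappa> i) / 3"
      "\<mu> \<bullet> (w j - w 0) = of_int l + of_int m * of_int (\<kappa> j) / 3"
      using key[OF ij(1)] key[OF ij(2)] by blast
    moreover have "\<mu> \<bullet> (w i - w j) = \<mu> \<bullet> (w i - w 0) - \<mu> \<bullet> (w j - w 0)" by (simp add: inner_diff_right)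
    ultimately have "\<mu> \<bullet> (w i - w j) = of_int (3 * (k - l) + m * (\<kappa> i - \<kappa> j)) / 3"
      by (simp add: field_simps)
    then show ?thesis by blast
  qed
  have quot: "expo \<mu> (w i) = expo \<mu> (w j) * expo \<mu> (w i - w j)" for i j
    by (simp add: expo_add_right[symmetric])
  have cubes: "expo \<mu> (w i) ^ 3 = expo \<mu> (w j) ^ 3" if ij: "i < 3" "j < 3" for i j
  proof -
    have "(of_nat 3 *\<^sub>R \<mu>) \<bullet> (w i - w j) \<in> \<int>"
    proof -
      obtain k :: int where "\<mu> \<bullet> (w i - w j) = of_int (3 * k + m * (\<kappa> i - \<kappa> j)) / 3" using diff[OF ij] by blast
      then have "(of_nat 3 *\<^sub>R \<mu>) \<bullet> (w i - w j) = of_int (3 * k + m * (\<kappa> i - \<kappa> j))"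
        unfolding inner_scaleR_left by (simp only: of_nat_numeral) simp
      then show ?thesis by (simp only: Ints_of_int)
    qed
    then have "expo \<mu> (w i - w j) ^ 3 = 1" unfolding expo_of_nat[symmetric] expo_eq_1_iff .
    then show ?thesis by (simp add: quot[of i j] power_mult_distrib)
  qed
  have ne: "expo \<mu> (w i) \<noteq> expo \<mu> (w j)" if ij: "i < 3" "j < 3" "i \<noteq> j" for i j
  proof
    assume "expo \<mu> (w i) = expo \<mu> (w j)"
    then have "expo \<mu> (w i - w j) = 1" using quot[of i j] by simp
    then obtain l :: int where l: "\<mu> \<bullet> (w i - w j) = of_int l" unfolding expo_eq_1_iff by (auto elim: Ints_cases)
    obtain k :: int where k: "\<mu> \<bullet> (w i - w j) = of_int (3 * k + m * (\<kappa> i - \<kappa> j)) / 3" using diff[OF ij(1,2)] by blast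
    have "real_of_int (3 * k + m * (\<kappa> i - \<kappa> j)) = of_int (3 * l)" using k l by simp
    then have "m * (\<kappa> i - \<kappa> j) = 3 * (l - k)" by (simp only: of_int_eq_iff) (simp add: algebra_simps)
    then have "3 dvd m * (\<kappa> i - \<kappa> j)" by simp
    moreover have "prime (3::int)" by simp
    ultimately have "3 dvd m \<or> 3 dvd \<kappa> i - \<kappa> j" using prime_dvd_mult_iff by blast
    then show False using m \<kappa>[OF ij] by (auto simp: mod_eq_dvd_iff)
  qed
  have "expo \<mu> (w 0) + expo \<mu> (w 1) + expo \<mu> (w 2) = 0"
    by (intro sum_eq_0_of_cubes_eq cubes ne) auto
  then show ?thesis by (simp add: numeral_3_eq_3 numeral_2_eq_2)
qed

text \<open>If the difference of the frequencies has a nonzero integer coordinate, the integral over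
  each single cube vanishes. Otherwise the frequencies come from different cosets, and the three
  cubes cancel one another.\<close>

lemma spectrum_orthogonal:
  assumes "l \<in> spectrum" "l' \<in> spectrum" "l \<noteq> l'"
  shows "expo_integral (l - l') \<Omega> = 0"
proof -
  obtain n j n' j' where l: "n \<in> int_lattice" "j < 3" "l = dual_shear (n + of_nat j *\<^sub>R step)"
    and l': "n' \<in> int_lattice" "j' < 3" "l' = dual_shear (n' + of_nat j' *\<^sub>R step)"
    using assms(1,2) by (auto simp: spectrum_def)
  define d where "d = n - n'"
  define m where "m = int j - int j'"
  define \<mu> where "\<mu> = l - l'"
  have d: "d \<in> int_lattice" using l l' by (simp add: d_def int_lattice_closed)
  have \<mu>: "\<mu> = dual_shear (d + of_int m *\<^sub>R step)"
    unfolding \<mu>_def l(3) l'(3) dual_shear_linear(2)[symmetric]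
    by (rule arg_cong[of _ _ dual_shear]) (simp add: d_def m_def algebra_simps)
  show ?thesis
  proof (cases "\<exists>b\<in>Basis. \<mu> \<bullet> b \<in> \<int> \<and> \<mu> \<bullet> b \<noteq> 0")
    case True
    then have "expo_integral \<mu> (unit_cube 0) = 0" using expo_integral_unit_cube_eq_0 by blast
    then show ?thesis by (simp add: expo_integral_\<Omega> flip: \<mu>_def)
  next
    case False
    \<comment> \<open>Within one coset the e-coordinate of the difference is an integer, hence 0;
      the transposed shear then acts trivially, the difference is a lattice vector, and all its
      coordinates vanish.\<close>
    have "m \<noteq> 0"
    proof
      assume "m = 0"
      then have \<mu>d: "\<mu> = d - (\<rho> * (d \<bullet> e)) *\<^sub>R g" by (simp add: \<mu> dual_shear_def)
      have de: "d \<bullet> e = 0"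
      proof -
        have "\<mu> \<bullet> e = d \<bullet> e" by (simp add: \<mu>d inner_diff_left)
        moreover have "d \<bullet> e \<in> \<int>" using d e by (simp add: int_lattice_def)
        ultimately show ?thesis using False e by force
      qed
      then have "\<mu> = d" by (simp add: \<mu>d)
      then have "d \<bullet> b = 0" if "b \<in> Basis" for b
        using False d that unfolding int_lattice_def by blast
      then have "d = 0" by (intro iffD1[OF euclidean_all_zero_iff]) simp
      then show False using \<open>\<mu> = d\<close> assms(3) by (simp add: \<mu>_def)
    qed
    moreover have "\<bar>m\<bar> < 3" using l(2) l'(2) by (auto simp: m_def)
    ultimately have "m mod 3 \<noteq> 0" by presburger
    from expo_sum_0[OF d this \<mu>] have "(\<Sum>i<3. expo \<mu> (w i)) = 0" using False by blast
    then show ?thesis by (simp add: expo_integral_\<Omega> flip: \<mu>_def)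
  qed
qed

lemma spectral:
  assumes adm: "admissible_domain \<Omega>"
  shows "is_spectral \<Omega>"
proof -
  have bd: "bounded \<Omega>" using adm by (simp add: admissible_domain_def)
  have op: "open \<Omega>" by (auto simp: \<Omega> unit_cube_eq_box)
  have borel [measurable]: "\<Omega> \<in> sets borel" using op by simp
  have lm: "\<Omega> \<in> lmeasurable" using bd op by (rule lmeasurable_open)
  have ne: "\<Omega> \<noteq> UNIV" using bd not_bounded_UNIV by auto
  define V where "V = measure lebesgue \<Omega>"
  have V: "V > 0"
    using adm lm unfolding V_def admissible_domain_def by (simp add: measure_def enn2real_positive_iff)
  have "finite_measure (lebesgue_on \<Omega>)" using lm by (rule finite_measure_lebesgue_on)
  then interpret finite_measure "lebesgue_on \<Omega>" .
  have mV: "measure (lebesgue_on \<Omega>) (space (lebesgue_on \<Omega>)) = V"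
    using lm by (simp add: V_def measure_restrict_space)
  have me [measurable]: "expo l \<in> borel_measurable (lebesgue_on \<Omega>)" for l
    by (rule continuous_imp_measurable_on_sets_lebesgue[OF continuous_on_expo]) (use lm in auto)
  have basis: "expo l \<in> L2_fun (lebesgue_on \<Omega>)" "L2_norm (lebesgue_on \<Omega>) (expo l) \<noteq> 0" for l
    using V mV by (simp_all add: L2_fun_def L2_norm_def)
  have orth: "L2_inner (lebesgue_on \<Omega>) (expo l) (expo l') = 0" if "l \<in> spectrum" "l' \<in> spectrum" "l \<noteq> l'" for l l'
  proof -
    have "L2_inner (lebesgue_on \<Omega>) (expo l) (expo l') = (\<integral>x. expo (l - l') x \<partial>lebesgue_on \<Omega>)"
      unfolding L2_inner_def by (simp add: expo_minus[symmetric] expo_add[symmetric])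
    also have "\<dots> = expo_integral (l - l') \<Omega>" by (rule integral_lebesgue_on_expo[OF borel])
    finally show ?thesis using spectrum_orthogonal[OF that] by simp
  qed
  have dense: "\<exists>F c. finite F \<and> F \<subseteq> spectrum \<and>
      L2_norm (lebesgue_on \<Omega>) (\<lambda>x. f x - (\<Sum>l\<in>F. c l * expo l x)) < \<epsilon>"
    if f: "f \<in> L2_fun (lebesgue_on \<Omega>)" and "\<epsilon> > 0" for f \<epsilon>
  proof -
    have [measurable]: "f \<in> borel_measurable (lebesgue_on \<Omega>)" and
      fint: "integrable (lebesgue_on \<Omega>) (\<lambda>x. (norm (f x))\<^sup>2)" using f by (auto simp: L2_fun_def)
    obtain G r where G: "continuous_on UNIV G" "\<And>x. x \<notin> \<Omega> \<Longrightarrow> G x = 0" "\<And>x. norm (G x) \<le> r"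
      "(\<integral>x. (norm (f x - G x))\<^sup>2 \<partial>lebesgue_on \<Omega>) < \<epsilon>\<^sup>2 / 4"
      using continuous_dense_L2[OF f lm op ne, of "\<epsilon>\<^sup>2 / 4"] \<open>\<epsilon> > 0\<close> by auto
    have [measurable]: "G \<in> borel_measurable (lebesgue_on \<Omega>)"
      by (rule continuous_imp_measurable_on_sets_lebesgue[OF continuous_on_subset[OF G(1)]]) (use lm in auto)
    define \<eta> where "\<eta> = sqrt (\<epsilon>\<^sup>2 / (4 * V))"
    have \<eta>: "\<eta> > 0" "\<eta>\<^sup>2 * V = \<epsilon>\<^sup>2 / 4" using V \<open>\<epsilon> > 0\<close> by (simp_all add: \<eta>_def)
    obtain q where q: "expo_span spectrum q" "\<And>x. x \<in> \<Omega> \<Longrightarrow> norm (G x - q x) < \<eta>"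
      using uniform_approximation_by_spectrum[OF G(1,2) bd \<eta>(1)] by blast
    obtain F c where F: "finite F" "F \<subseteq> spectrum" "q = (\<lambda>x. \<Sum>l\<in>F. c l * expo l x)"
      using q(1) unfolding expo_span_def by blast
    have i1: "integrable (lebesgue_on \<Omega>) (\<lambda>x. (norm (f x - G x))\<^sup>2)"
    proof (rule Bochner_Integration.integrable_bound)
      show "integrable (lebesgue_on \<Omega>) (\<lambda>x. 2 * (norm (f x))\<^sup>2 + 2 * r\<^sup>2)" using fint by simp
      have "(norm (f x - G x))\<^sup>2 \<le> 2 * (norm (f x))\<^sup>2 + 2 * r\<^sup>2" for x
      proof -
        have "(norm (G x))\<^sup>2 \<le> r\<^sup>2" using G(3) by (intro power_mono) auto
        then show ?thesis using square_norm_add_le[of "f x" "- G x"] by simp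
      qed
      then show "AE x in lebesgue_on \<Omega>. norm ((norm (f x - G x))\<^sup>2) \<le> norm (2 * (norm (f x))\<^sup>2 + 2 * r\<^sup>2)"
        by (intro AE_I2) simp
    qed measurable
    have "(\<integral>x. (norm (f x - q x))\<^sup>2 \<partial>lebesgue_on \<Omega>) \<le> (\<integral>x. 2 * (norm (f x - G x))\<^sup>2 + 2 * \<eta>\<^sup>2 \<partial>lebesgue_on \<Omega>)"
    proof (rule integral_mono_AE')
      show "AE x in lebesgue_on \<Omega>. (norm (f x - q x))\<^sup>2 \<le> 2 * (norm (f x - G x))\<^sup>2 + 2 * \<eta>\<^sup>2"
      proof (rule AE_I2)
        fix x assume "x \<in> space (lebesgue_on \<Omega>)"
        then have "(norm (G x - q x))\<^sup>2 \<le> \<eta>\<^sup>2" using q(2)[of x] by (intro power_mono) auto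
        then show "(norm (f x - q x))\<^sup>2 \<le> 2 * (norm (f x - G x))\<^sup>2 + 2 * \<eta>\<^sup>2"
          using square_norm_add_le[of "f x - G x" "G x - q x"] by simp
      qed
    qed (use i1 in auto)
    also have "\<dots> = 2 * (\<integral>x. (norm (f x - G x))\<^sup>2 \<partial>lebesgue_on \<Omega>) + 2 * (\<eta>\<^sup>2 * V)"
      using i1 mV by simp
    also have "\<dots> < \<epsilon>\<^sup>2" using G(4) \<eta>(2) by simp
    finally have "L2_norm (lebesgue_on \<Omega>) (\<lambda>x. f x - q x) < \<epsilon>"
      unfolding L2_norm_def using \<open>\<epsilon> > 0\<close> by (simp add: real_less_lsqrt real_sqrt_less_iff)
    then show ?thesis using F by auto
  qed
  show ?thesis
    unfolding is_spectral_def orthogonal_basis_L2_def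
    by (intro conjI adm exI[of _ spectrum] countable_spectrum ballI impI allI basis orth dense)
qed

end

section \<open>Weak tilings by three cubes\<close>

lemma AE_lebesgue_translate:
  fixes t :: "'a::euclidean_space"
  assumes "AE x in lebesgue. P x"
  shows "AE x in lebesgue. P (x + t)"
proof -
  obtain Z where Z: "negligible Z" "{x. \<not> P x} \<subseteq> Z"
    using assms unfolding eventually_ae_filter negligible_iff_null_sets by auto
  have "negligible ((+) (- t) ` Z)" using Z(1) by (rule negligible_translation)
  moreover have "{x. \<not> P (x + t)} \<subseteq> (+) (- t) ` Z"
  proof
    fix x assume "x \<in> {x. \<not> P (x + t)}"
    then have "x + t \<in> Z" using Z(2) by blast
    moreover have "x = - t + (x + t)" by simp
    ultimately show "x \<in> (+) (- t) ` Z" by blast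
  qed
  ultimately show ?thesis
    unfolding eventually_ae_filter negligible_iff_null_sets by auto
qed

lemma mem_box_minus_One: "z \<in> box (x - One) x \<longleftrightarrow> x - z \<in> box 0 (One :: 'a::euclidean_space)"
  by (auto simp: mem_box inner_diff_left less_diff_eq diff_less_eq add.commute)

locale locally_finite =
  fixes \<mu> :: "'a::euclidean_space measure"
  assumes lf: "locally_finite_borel_measure \<mu>"
begin

lemma sets_locally_finite [measurable_cong, simp]: "sets \<mu> = sets borel"
  using lf by (simp add: locally_finite_borel_measure_def)

text \<open>This is \<nu>: the pushforward of counting measure on one point is the unit mass at
  0.\<close>

definition with_atom :: "'a measure" where
  "with_atom = plus_measure \<mu> (distr (count_space {()}) borel (\<lambda>_. 0))"

lemma sets_with_atom [measurable_cong, simp]: "sets with_atom = sets borel"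
  by (simp add: with_atom_def)

lemma emeasure_with_atom: "A \<in> sets borel \<Longrightarrow> emeasure with_atom A = emeasure \<mu> A + indicator A 0"
  by (cases "0 \<in> A") (simp_all add: with_atom_def emeasure_plus_measure emeasure_distr)

text \<open>This is F(x): for the open unit cube Q, x - z lies in Q exactly when z lies in this
  box.\<close>

definition box_mass :: "'a \<Rightarrow> ennreal" where
  "box_mass x = emeasure with_atom (box (x - One) x)"

lemma sum_box_mass:
  assumes \<Omega>: "\<Omega> = unit_cube a \<union> unit_cube b \<union> unit_cube c"
    and disj: "unit_cube a \<inter> unit_cube b = {}" "unit_cube a \<inter> unit_cube c = {}" "unit_cube b \<inter> unit_cube c = {}"
  shows "box_mass (x - a) + box_mass (x - b) + box_mass (x - c) = indicator_conv \<Omega> \<mu> x + indicator \<Omega> x"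
proof -
  define Q where "Q p = box (x - p - One) (x - p)" for p
  have [measurable]: "Q p \<in> sets borel" for p by (simp add: Q_def)
  have Q: "indicator (Q p) z = (indicator (unit_cube p) (x - z) :: ennreal)" for p z
  proof -
    have "z \<in> Q p \<longleftrightarrow> x - z \<in> unit_cube p"
      unfolding Q_def mem_box_minus_One mem_unit_cube_iff_box by (simp add: algebra_simps)
    then show ?thesis by (simp add: indicator_def)
  qed
  have ind: "indicator \<Omega> y = indicator (unit_cube a) y + indicator (unit_cube b) y + (indicator (unit_cube c) y :: ennreal)" for y
    using disj by (auto simp: \<Omega> indicator_def)
  have "indicator_conv \<Omega> \<mu> x = (\<integral>\<^sup>+ z. indicator (Q a) z + indicator (Q b) z + indicator (Q c) z \<partial>\<mu>)"
    unfolding indicator_conv_def ind Q ..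
  also have "\<dots> = emeasure \<mu> (Q a) + emeasure \<mu> (Q b) + emeasure \<mu> (Q c)"
    by (simp add: nn_integral_add)
  finally have conv: "indicator_conv \<Omega> \<mu> x = \<dots>" .
  have "box_mass (x - p) = emeasure \<mu> (Q p) + indicator (unit_cube p) x" for p
    using Q[of p 0] by (simp add: box_mass_def emeasure_with_atom Q_def)
  then show ?thesis by (simp add: conv ind add_ac)
qed

definition tripled :: "'a \<Rightarrow> 'a measure" where
  "tripled m = plus_measure with_atom
     (plus_measure (distr with_atom borel (\<lambda>x. x + m)) (distr with_atom borel (\<lambda>x. x - m)))"

lemma sets_tripled [simp]: "sets (tripled m) = sets borel"
  by (simp add: tripled_def)

lemma space_with_atom [simp]: "space with_atom = UNIV"
  using sets_eq_imp_space_eq[OF sets_with_atom] by simp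

lemma emeasure_tripled:
  assumes [measurable]: "A \<in> sets borel"
  shows "emeasure (tripled m) A = emeasure with_atom A
    + (emeasure with_atom ((\<lambda>x. x + m) -` A) + emeasure with_atom ((\<lambda>x. x - m) -` A))"
  by (simp add: tripled_def emeasure_plus_measure emeasure_distr)

lemma emeasure_tripled_box:
  "emeasure (tripled m) (box (x - One) x) = box_mass x + box_mass (x - m) + box_mass (x + m)"
proof -
  have "(\<lambda>z. z + m) -` box (x - One) x = box (x - m - One) (x - m)"
    "(\<lambda>z. z - m) -` box (x - One) x = box (x + m - One) (x + m)"
    by (intro set_eqI; unfold vimage_eq mem_box_minus_One; simp add: algebra_simps)+
  then show ?thesis by (simp add: emeasure_tripled box_mass_def add.assoc)
qed

lemma locally_finite_tripled: "locally_finite_borel_measure (tripled m)"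
  unfolding locally_finite_borel_measure_def
proof (intro conjI allI)
  fix x :: 'a
  have fin: "emeasure with_atom (ball y 1) < \<infinity>" for y
    using finite_emeasure_bounded[OF lf, of "ball y 1"] by (simp add: emeasure_with_atom indicator_def)
  have "(\<lambda>z. z + m) -` ball x 1 = ball (x - m) 1" "(\<lambda>z. z - m) -` ball x 1 = ball (x + m) 1"
    by (auto simp: dist_norm algebra_simps)
  then have "emeasure (tripled m) (ball x 1) < \<infinity>"
    using fin[of x] fin[of "x - m"] fin[of "x + m"] by (simp add: emeasure_tripled)
  then show "\<exists>U. open U \<and> x \<in> U \<and> emeasure (tripled m) U < \<infinity>"
    by (intro exI[of _ "ball x 1"]) simp
qed simp

lemma nonzero_integer_coordinate:
  assumes dim: "DIM('a) \<in> {1, 2}"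
    and ae: "AE x in lebesgue. box_mass x + box_mass (x - m) + box_mass (x + m) = 1"
  shows "\<exists>i\<in>Basis. m \<bullet> i \<in> \<int> \<and> m \<bullet> i \<noteq> 0"
proof -
  interpret unit_box_mass "tripled m"
  proof
    show "emeasure (tripled m) (hbox S p) = 1" for S p
      by (rule hbox_emeasure_1[OF locally_finite_tripled]) (simp add: emeasure_tripled_box ae)
  qed simp
  have vim: "(\<lambda>x. x + m) -` {y} = {y - m}" for y by (auto simp: algebra_simps)
  have atom0: "emeasure with_atom {0} \<ge> 1" by (simp add: emeasure_with_atom)
  have fin: "emeasure (tripled m) {y} \<noteq> \<infinity>" for y
    using fmeasurableD2[OF fmeasurable_singleton] by simp
  have 0: "emeasure (tripled m) {0} \<ge> 1"
    using atom0 by (simp add: emeasure_tripled add_increasing2)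
  have m: "emeasure (tripled m) {m} \<ge> emeasure with_atom {m} + 1"
    using atom0 by (simp add: emeasure_tripled vim add_left_mono add_increasing2)
  have me: "measure (tripled m) {y} \<ge> 1" if "emeasure (tripled m) {y} \<ge> 1" for y
    using that fin[of y] by (simp add: emeasure_eq_ennreal_measure)
  \<comment> \<open>For m = 0 the atoms at 0 and m coincide, giving a point of mass at least 2
    inside a box of mass 1.\<close>
  have "m \<noteq> 0"
  proof
    assume "m = 0"
    then have "emeasure (tripled m) {0} \<ge> 2"
      using m add_mono[OF atom0 order_refl[of 1]] by (simp add: order_trans)
    also have "emeasure (tripled m) {0} \<le> emeasure (tripled m) (hbox UNIV 0)"
      by (rule emeasure_mono) (auto simp: hbox_def half_open_def)
    finally have "2 \<le> (1 :: ennreal)" by (simp only: hbox_mass)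
    then show False by simp
  qed
  moreover have "emeasure (tripled m) {m} \<ge> 1" using m by (rule order_trans[rotated]) simp
  ultimately show ?thesis
    using atoms_nonzero_integer_coordinate[OF dim] me 0 by blast
qed

text \<open>The harmonic argument needs the relation at every point of an orbit. The set
  \<open>X\<close> of points whose whole orbit is good is invariant and, as a countable intersection
  of sets of full measure, has full measure. On it F is at most 1, so real arithmetic applies, and
  subtracting 1/3 makes the relation homogeneous.\<close>

lemma box_mass_spread:
  assumes ae: "AE x in lebesgue. box_mass x + box_mass (x - u) + box_mass (x - v) = 1"
    and ij: "(i - j) mod 3 \<noteq> (0::int)"
  defines "m \<equiv> of_int i *\<^sub>R u + of_int j *\<^sub>R v"
  shows "AE x in lebesgue. box_mass x + box_mass (x - m) + box_mass (x + m) = 1"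
proof -
  define good where "good x \<longleftrightarrow> box_mass x + box_mass (x - u) + box_mass (x - v) = 1" for x
  define X where "X = {x. \<forall>i j :: int. good (x + (of_int i *\<^sub>R u + of_int j *\<^sub>R v))}"
  have "AE x in lebesgue. good (x + t)" for t
    using AE_lebesgue_translate[OF ae, of t] by (simp add: good_def)
  then have AEX: "AE x in lebesgue. x \<in> X"
    by (simp add: X_def AE_all_countable)
  have XG: "good x" if "x \<in> X" for x
  proof -
    have "good (x + (of_int 0 *\<^sub>R u + of_int 0 *\<^sub>R v))" using that unfolding X_def by blast
    then show ?thesis by simp
  qed
  have cl: "x + of_int k *\<^sub>R u + of_int l *\<^sub>R v \<in> X" if "x \<in> X" for x and k l :: int
    unfolding X_def
  proof (intro CollectI allI)
    fix i j :: int
    have "good (x + (of_int (k + i) *\<^sub>R u + of_int (l + j) *\<^sub>R v))" using that unfolding X_def by blast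
    then show "good (x + of_int k *\<^sub>R u + of_int l *\<^sub>R v + (of_int i *\<^sub>R u + of_int j *\<^sub>R v))"
      by (simp add: algebra_simps)
  qed
  define f where "f x = enn2real (box_mass x)" for x
  have le1: "box_mass x \<le> 1" if "x \<in> X" for x
  proof -
    have "box_mass x \<le> box_mass x + box_mass (x - u) + box_mass (x - v)" by (simp add: add.assoc)
    also have "\<dots> = 1" using XG[OF that] by (simp add: good_def)
    finally show ?thesis .
  qed
  have f: "box_mass x = ennreal (f x)" "0 \<le> f x" "f x \<le> 1" if "x \<in> X" for x
  proof -
    have "box_mass x < top" using le1[OF that] by (rule order_le_less_trans) simp
    then show "box_mass x = ennreal (f x)" by (simp add: f_def)
    show "0 \<le> f x" by (simp add: f_def)
    show "f x \<le> 1" using enn2real_mono[OF le1[OF that]] by (simp add: f_def)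
  qed
  have sum1: "f x + f y + f z = 1 \<longleftrightarrow> box_mass x + box_mass y + box_mass z = 1" if "x \<in> X" "y \<in> X" "z \<in> X" for x y z
    using f[OF that(1)] f[OF that(2)] f[OF that(3)]
    by (simp flip: ennreal_plus)
  have bd: "\<bar>f x - 1 / 3\<bar> \<le> 1" if "x \<in> X" for x using f(2,3)[OF that] by (simp add: abs_le_iff)
  have mX: "x - u \<in> X" "x - v \<in> X" "x - m \<in> X" "x + m \<in> X" if "x \<in> X" for x
    using cl[OF that, of "-1" 0] cl[OF that, of 0 "-1"] cl[OF that, of "-i" "-j"] cl[OF that, of i j]
    by (simp_all add: m_def algebra_simps)
  have rel: "(f x - 1 / 3) + (f (x - u) - 1 / 3) + (f (x - v) - 1 / 3) = 0" if "x \<in> X" for x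
    using sum1[OF that mX(1,2)[OF that]] XG[OF that] by (simp add: good_def)
  have "box_mass x + box_mass (x - m) + box_mass (x + m) = 1" if x: "x \<in> X" for x
  proof -
    have "(f x - 1 / 3) + (f (x - m) - 1 / 3) + (f (x + m) - 1 / 3) = 0"
      unfolding m_def
      by (rule three_term_relation_spread[where h = "\<lambda>x. f x - 1 / 3" and X = X, OF cl bd rel ij x])
    then show ?thesis using sum1[OF x mX(3,4)[OF x]] by simp
  qed
  then show ?thesis using AEX by (auto elim: eventually_mono)
qed

end

theorem theorem1p5:
  fixes \<Omega> :: "'a::euclidean_space set" and a b c :: 'a
  assumes "DIM('a) \<in> {1, 2}"
    and "\<Omega> = unit_cube a \<union> unit_cube b \<union> unit_cube c"
    and "unit_cube a \<inter> unit_cube b = {}"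
    and "unit_cube a \<inter> unit_cube c = {}"
    and "unit_cube b \<inter> unit_cube c = {}"
    and "is_weak_tile \<Omega>"
  shows "is_tile \<Omega> \<and> is_spectral \<Omega>"
proof -
  have adm: "admissible_domain \<Omega>" using assms(6) by (simp add: is_weak_tile_def)
  obtain \<mu> where lf: "locally_finite_borel_measure \<mu>"
    and conv: "AE x in lebesgue. indicator_conv \<Omega> \<mu> x = indicator (- \<Omega>) x"
    using assms(6) unfolding is_weak_tile_def by blast
  interpret locally_finite \<mu> by unfold_locales (rule lf)
  define u v where "u = b - a" and "v = c - a"
  have "AE x in lebesgue. box_mass (x - a) + box_mass (x - b) + box_mass (x - c) = 1"
    using conv
  proof eventually_elim
    case (elim x)
    have "indicator (- \<Omega>) x + indicator \<Omega> x = (1 :: ennreal)" by (simp add: indicator_def)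
    then show ?case using sum_box_mass[OF assms(2-5), of x] elim by simp
  qed
  from AE_lebesgue_translate[OF this, of a]
  have rel: "AE x in lebesgue. box_mass x + box_mass (x - u) + box_mass (x - v) = 1"
    by (simp add: u_def v_def algebra_simps)
  have K: "\<exists>e\<in>Basis. (of_int i *\<^sub>R u + of_int j *\<^sub>R v) \<bullet> e \<in> \<int> \<and> (of_int i *\<^sub>R u + of_int j *\<^sub>R v) \<bullet> e \<noteq> 0"
    if "(i - j) mod 3 \<noteq> 0" for i j :: int
    by (rule nonzero_integer_coordinate[OF assms(1) box_mass_spread[OF rel that]])
  obtain e g :: 'a and \<rho> :: real and N \<beta> \<gamma> :: int where nf:
    "e \<in> Basis" "g = 0 \<or> g \<in> Basis" "g \<noteq> e" "N > 0" "u \<bullet> g \<in> \<int>" "v \<bullet> g \<in> \<int>"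
    "u \<bullet> e - \<rho> * (u \<bullet> g) = of_int (N * \<beta>)" "v \<bullet> e - \<rho> * (v \<bullet> g) = of_int (N * \<gamma>)"
    "\<beta> mod 3 \<noteq> 0" "\<gamma> mod 3 \<noteq> 0" "\<beta> mod 3 \<noteq> \<gamma> mod 3"
    by (rule lattice_normal_form[OF assms(1) K]; (rule that)?; assumption?)
  \<comment> \<open>Based at a, the displacements are 0, u, v; the value 0 of
    \<open>\<kappa>\<close> at 0 completes \<beta> and \<gamma> to a residue system modulo
    3.\<close>
  define w where "w i = (if i = 0 then a else if i = 1 then b else c)" for i :: nat
  define \<kappa> where "\<kappa> i = (if i = 0 then 0 else if i = 1 then \<beta> else \<gamma>)" for i :: nat
  interpret three_cubes e g \<rho> N w \<kappa> \<Omega>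
  proof
    show "\<Omega> = (\<Union>i<3. unit_cube (w i))"
      unfolding assms(2) by (auto simp: w_def numeral_3_eq_3 lessThan_Suc)
    show "(w i - w 0) \<bullet> g \<in> \<int>" for i
      using nf by (simp add: w_def flip: u_def v_def)
    show "(w i - w 0) \<bullet> e - \<rho> * ((w i - w 0) \<bullet> g) = of_int (N * \<kappa> i)" for i
      using nf(7,8) by (simp add: w_def \<kappa>_def flip: u_def v_def)
    show "\<kappa> i mod 3 \<noteq> \<kappa> j mod 3" if "i < 3" "j < 3" "i \<noteq> j" for i j
      using that nf by (auto simp: \<kappa>_def)
  qed (use nf in auto)
  show ?thesis using tiles[OF adm] spectral[OF adm] ..
qed

end
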